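(* Let $h$ be a convex normal integrand on $[0,T]\times\mathbb{R}^d$ and $\mu$ a positive atomless Radon measure on $[0,T]$ with support $[0,T]$. Assume that the set-valued mapping $t\mapsto \operatorname{dom} h_t$ is left-inner semicontinuous, and that for every $x\in X$, $$x\in \operatorname{int} L^\infty(\operatorname{dom} h)\ \Longrightarrow\ x\in \operatorname{dom} I_h\ \Longrightarrow\ x_t\in \operatorname{cl}\operatorname{dom} h_t\ \ \forall t\in[0,T].$$ If $I_h$ is proper on $X$ (i.e. $I_h>-\infty$ on $X$ and $I_h\not\equiv+\infty$ on $X$) and $X\cap \operatorname{int} L^\infty(\operatorname{dom} h)\neq\emptyset$, then $$\inf_{x\in X}\int_{[0,T]} h_t(x_t)\,d\mu_t=\int_{[0,T]}\inf_{x\in\mathbb{R}^d} h_t(x)\,d\mu_t .$$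
   Context: Fix $T>0$, $d\ge1$. $X$ is the space of left-continuous functions $x:\mathbb{R}\to\mathbb{R}^d$ of bounded variation that are constant on $(-\infty,0]$ and on $(T,\infty)$. A convex normal integrand on $[0,T]\times\mathbb{R}^d$ is a function $h:[0,T]\times\mathbb{R}^d\to\mathbb{R}\cup\{+\infty\}$, $(t,x)\mapsto h_t(x)$, such that each $h_t$ is convex and $t\mapsto \operatorname{epi}h_t=\{(x,\alpha): h_t(x)\le\alpha\}$ is closed-valued and Borel measurable (inverse images of open sets are Borel). $\operatorname{dom}h_t=\{x\in\mathbb{R}^d: h_t(x)<\infty\}$. For measurable $x:[0,T]\to\mathbb{R}^d$, $I_h(x):=\int_{[0,T]} h_t(x_t)\,d\mu_t$, where the integral is defined as $+\infty$ unless the positive part of the integrand is integrable; $\operatorname{dom} I_h=\{x: I_h(x)<\infty\}$. Let $\tau$ be the topology on $[0,T]$ generated by the left-open intervals $(s,t]$; a set-valued mapping $S:[0,T]\rightrightarrows\mathbb{R}^d$ is left-inner semicontinuous if $\{t: S_t\cap A\ne\emptyset\}$ is $\tau$-open for every open $A\subseteq\mathbb{R}^d$. For a measurable set-valued $S$, $L^\infty(S):=\{x\in L^\infty([0,T],\mu;\mathbb{R}^d): x_t\in S_t\ \mu\text{-a.e.}\}$, and $\operatorname{int}$ denotes interior in the norm topology of $L^\infty([0,T],\mu;\mathbb{R}^d)$ (elements of $X$ are identified with their $\mu$-equivalence classes on $[0,T]$). *)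

theory Defs
  imports "HOL-Analysis.Analysis"
begin

definition bounded_variation :: "(real \<Rightarrow> 'a::real_normed_vector) \<Rightarrow> bool" where
  "bounded_variation x \<longleftrightarrow>
     (\<exists>B. \<forall>(n::nat) (s::nat \<Rightarrow> real). (\<forall>i<n. s i \<le> s (Suc i)) \<longrightarrow>
        (\<Sum>i<n. norm (x (s (Suc i)) - x (s i))) \<le> B)"

definition BVspace :: "real \<Rightarrow> (real \<Rightarrow> 'a::real_normed_vector) set" where
  "BVspace T = {x. (\<forall>t. continuous (at_left t) x) \<and> bounded_variation x
      \<and> (\<forall>s t. s \<le> 0 \<longrightarrow> t \<le> 0 \<longrightarrow> x s = x t)
      \<and> (\<forall>s t. s > T \<longrightarrow> t > T \<longrightarrow> x s = x t)}"

definition epi :: "('a \<Rightarrow> ereal) \<Rightarrow> ('a \<times> real) set" where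
  "epi f = {(x, \<alpha>). f x \<le> ereal \<alpha>}"

definition edom :: "('a \<Rightarrow> ereal) \<Rightarrow> 'a set" where
  "edom f = {x. f x < \<infinity>}"

definition convex_normal_integrand :: "real \<Rightarrow> (real \<Rightarrow> 'a::euclidean_space \<Rightarrow> ereal) \<Rightarrow> bool" where
  "convex_normal_integrand T h \<longleftrightarrow>
     (\<forall>t\<in>{0..T}. \<forall>x. h t x \<noteq> -\<infinity>)
   \<and> (\<forall>t\<in>{0..T}. convex (epi (h t)))
   \<and> (\<forall>t\<in>{0..T}. closed (epi (h t)))
   \<and> (\<forall>G::('a \<times> real) set. open G \<longrightarrow> {t\<in>{0..T}. epi (h t) \<inter> G \<noteq> {}} \<in> sets borel)"

definition eintegral :: "real measure \<Rightarrow> (real \<Rightarrow> ereal) \<Rightarrow> ereal" where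
  "eintegral \<mu> f =
     (if (\<integral>\<^sup>+ t. e2ennreal (f t) \<partial>\<mu>) < \<infinity>
      then enn2ereal (\<integral>\<^sup>+ t. e2ennreal (f t) \<partial>\<mu>) - enn2ereal (\<integral>\<^sup>+ t. e2ennreal (- f t) \<partial>\<mu>)
      else \<infinity>)"

definition Ih :: "real measure \<Rightarrow> (real \<Rightarrow> 'a \<Rightarrow> ereal) \<Rightarrow> (real \<Rightarrow> 'a) \<Rightarrow> ereal" where
  "Ih \<mu> h x = eintegral \<mu> (\<lambda>t. h t (x t))"

definition tau_open :: "real \<Rightarrow> real set \<Rightarrow> bool" where
  "tau_open T U \<longleftrightarrow> U \<subseteq> {0..T} \<and>
     (\<exists>V. generate_topology (range (\<lambda>(s,t). {s<..t})) V \<and> U = V \<inter> {0..T})"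

definition left_inner_semicontinuous :: "real \<Rightarrow> (real \<Rightarrow> 'a::topological_space set) \<Rightarrow> bool" where
  "left_inner_semicontinuous T S \<longleftrightarrow>
     (\<forall>A. open A \<longrightarrow> tau_open T {t\<in>{0..T}. S t \<inter> A \<noteq> {}})"

text \<open>Membership of x in the norm-interior of L^infty(S) inside L^infty([0,T],mu;R^d):
  some L^infty-ball around x consists of (classes of) measurable selections of S a.e.\<close>
definition in_int_Linf :: "real measure \<Rightarrow> (real \<Rightarrow> 'a::euclidean_space set) \<Rightarrow> (real \<Rightarrow> 'a) \<Rightarrow> bool" where
  "in_int_Linf \<mu> S x \<longleftrightarrow>
     x \<in> borel_measurable \<mu> \<and> (\<exists>B. AE t in \<mu>. norm (x t) \<le> B) \<and>
     (\<exists>\<epsilon>>0. \<forall>y \<in> borel_measurable \<mu>. (AE t in \<mu>. norm (y t - x t) \<le> \<epsilon>) \<longrightarrow> (AE t in \<mu>. y t \<in> S t))"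

end

theory Submission
  imports Defs
begin

text \<open>
  No measurable selection is needed.  Since almost every domain has interior points, the infimum of
  \<open>h\<^sub>t\<close> is the infimum of \<open>h\<^sub>t(v)\<close> over the \<open>v\<close> in a countable dense set
  that lie in the interior of the domain of \<open>h\<^sub>t\<close>.
  Left-inner semicontinuity keeps a ball around such a \<open>v\<close> inside the domains on some interval
  \<open>(s, t]\<close>; hence, up to a countable and thus null set of \<open>t\<close>, the infimum is already the infimum over
  countably many constants \<open>v\<^sub>n\<close>, each admissible with a uniform margin on an interval \<open>(a\<^sub>n, b\<^sub>n]\<close>
  with rational end points.  Start from a BV function \<open>x\<close> in the interior and successively replace the integrand
  by \<open>h\<^sub>t(v\<^sub>n)\<close> where this is smaller and \<open>t \<in> (a\<^sub>n, b\<^sub>n]\<close>: the resulting integrands decrease to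
  \<open>inf h\<^sub>t\<close>, and each is an \<open>L\<^sup>1\<close> limit of integrands \<open>h\<^sub>t(y\<^sub>t)\<close> with \<open>y\<close> an interior BV function,
  because measurable sets are approximated by finite unions of left-open intervals.  Monotone
  convergence concludes.
\<close>

subsection \<open>Left-continuous functions of bounded variation\<close>

lemma bounded_variation_bounded:
  assumes "bounded_variation x"
  shows "\<exists>B. \<forall>t. norm (x t) \<le> B"
proof -
  obtain B where B: "\<And>(n::nat) (s::nat \<Rightarrow> real). (\<forall>i<n. s i \<le> s (Suc i)) \<Longrightarrow>
      (\<Sum>i<n. norm (x (s (Suc i)) - x (s i))) \<le> B"
    using assms unfolding bounded_variation_def by blast
  have "norm (x t) \<le> B + norm (x 0)" for t
  proof -
    have "norm (x (max 0 t) - x (min 0 t)) \<le> B"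
      \<comment> \<open>The partition with the two points \<open>0\<close> and \<open>t\<close>,
        sorted because partitions must be nondecreasing.\<close>
      using B[of 1 "\<lambda>i. if i = 0 then min 0 t else max 0 t"] by auto
    hence "norm (x t - x 0) \<le> B"
      by (cases "t \<ge> 0") (auto simp: max_def min_def norm_minus_commute)
    thus ?thesis
      using norm_triangle_ineq[of "x t - x 0" "x 0"] by simp
  qed
  thus ?thesis by blast
qed

lemma bounded_variation_add:
  assumes "bounded_variation x" "bounded_variation y"
  shows "bounded_variation (\<lambda>t. x t + y t)"
proof -
  obtain A where A: "\<And>(n::nat) (s::nat \<Rightarrow> real). (\<forall>i<n. s i \<le> s (Suc i)) \<Longrightarrow>
      (\<Sum>i<n. norm (x (s (Suc i)) - x (s i))) \<le> A"
    using assms(1) unfolding bounded_variation_def by blast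
  obtain B where B: "\<And>(n::nat) (s::nat \<Rightarrow> real). (\<forall>i<n. s i \<le> s (Suc i)) \<Longrightarrow>
      (\<Sum>i<n. norm (y (s (Suc i)) - y (s i))) \<le> B"
    using assms(2) unfolding bounded_variation_def by blast
  have "(\<Sum>i<n. norm (x (s (Suc i)) + y (s (Suc i)) - (x (s i) + y (s i)))) \<le> A + B"
    if "\<forall>i<n. s i \<le> s (Suc i)" for n and s :: "nat \<Rightarrow> real"
  proof -
    have "(\<Sum>i<n. norm (x (s (Suc i)) + y (s (Suc i)) - (x (s i) + y (s i)))) \<le>
        (\<Sum>i<n. norm (x (s (Suc i)) - x (s i)) + norm (y (s (Suc i)) - y (s i)))"
      by (intro sum_mono norm_diff_triangle_ineq)
    also have "\<dots> \<le> A + B"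
      unfolding sum.distrib using A[OF that] B[OF that] by linarith
    finally show ?thesis .
  qed
  thus ?thesis unfolding bounded_variation_def by blast
qed

lemma bounded_variation_scaleR:
  fixes f :: "real \<Rightarrow> real"
  assumes "bounded_variation f" "bounded_variation x"
  shows "bounded_variation (\<lambda>t. f t *\<^sub>R x t)"
proof -
  obtain A where A: "\<And>(n::nat) (s::nat \<Rightarrow> real). (\<forall>i<n. s i \<le> s (Suc i)) \<Longrightarrow>
      (\<Sum>i<n. norm (f (s (Suc i)) - f (s i))) \<le> A"
    using assms(1) unfolding bounded_variation_def by blast
  obtain B where B: "\<And>(n::nat) (s::nat \<Rightarrow> real). (\<forall>i<n. s i \<le> s (Suc i)) \<Longrightarrow>
      (\<Sum>i<n. norm (x (s (Suc i)) - x (s i))) \<le> B"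
    using assms(2) unfolding bounded_variation_def by blast
  obtain F where F: "\<And>t. norm (f t) \<le> F"
    using bounded_variation_bounded[OF assms(1)] by blast
  obtain M where M: "\<And>t. norm (x t) \<le> M"
    using bounded_variation_bounded[OF assms(2)] by blast
  have nonneg: "0 \<le> F" "0 \<le> M"
    using F[of 0] M[of 0] norm_ge_zero order_trans by blast+
  have step: "norm (f b *\<^sub>R x b - f a *\<^sub>R x a) \<le> F * norm (x b - x a) + M * norm (f b - f a)" for a b
  proof -
    have "f b *\<^sub>R x b - f a *\<^sub>R x a = f b *\<^sub>R (x b - x a) + (f b - f a) *\<^sub>R x a"
      by (simp add: algebra_simps)
    also have "norm \<dots> \<le> norm (f b) * norm (x b - x a) + norm (x a) * norm (f b - f a)"
      by (metis norm_triangle_ineq norm_scaleR real_norm_def mult.commute)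
    also have "\<dots> \<le> F * norm (x b - x a) + M * norm (f b - f a)"
      by (intro add_mono mult_right_mono F M) auto
    finally show ?thesis .
  qed
  have "(\<Sum>i<n. norm (f (s (Suc i)) *\<^sub>R x (s (Suc i)) - f (s i) *\<^sub>R x (s i))) \<le> F * B + M * A"
    if "\<forall>i<n. s i \<le> s (Suc i)" for n and s :: "nat \<Rightarrow> real"
  proof -
    have "(\<Sum>i<n. norm (f (s (Suc i)) *\<^sub>R x (s (Suc i)) - f (s i) *\<^sub>R x (s i))) \<le>
        (\<Sum>i<n. F * norm (x (s (Suc i)) - x (s i)) + M * norm (f (s (Suc i)) - f (s i)))"
      by (intro sum_mono step)
    also have "\<dots> \<le> F * B + M * A"
      unfolding sum.distrib sum_distrib_left[symmetric]
      using A[OF that] B[OF that] nonneg by (intro add_mono mult_left_mono)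
    finally show ?thesis .
  qed
  thus ?thesis unfolding bounded_variation_def by blast
qed

lemma BVspace_const: "(\<lambda>t. c) \<in> BVspace T"
  by (auto simp: BVspace_def bounded_variation_def)

lemma BVspaceD:
  assumes "x \<in> BVspace T"
  shows "continuous (at_left t) x" "bounded_variation x"
    and "s \<le> 0 \<Longrightarrow> t \<le> 0 \<Longrightarrow> x s = x t"
    and "T < s \<Longrightarrow> T < t \<Longrightarrow> x s = x t"
  using assms unfolding BVspace_def by blast+

lemma BVspace_add:
  assumes "x \<in> BVspace T" "y \<in> BVspace T"
  shows "(\<lambda>t. x t + y t) \<in> BVspace T" (is "?z \<in> _")
  unfolding BVspace_def mem_Collect_eq
proof (intro conjI allI impI)
  fix s t :: real
  show "?z s = ?z t" if "s \<le> 0" "t \<le> 0"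
    using BVspaceD(3)[OF assms(1) that] BVspaceD(3)[OF assms(2) that] by simp
  show "?z s = ?z t" if "T < s" "T < t"
    using BVspaceD(4)[OF assms(1) that] BVspaceD(4)[OF assms(2) that] by simp
qed (auto intro!: continuous_add bounded_variation_add BVspaceD(1,2)[OF assms(1)] BVspaceD(1,2)[OF assms(2)])

lemma BVspace_scaleR:
  fixes f :: "real \<Rightarrow> real"
  assumes "f \<in> BVspace T" "x \<in> BVspace T"
  shows "(\<lambda>t. f t *\<^sub>R x t) \<in> BVspace T" (is "?z \<in> _")
  unfolding BVspace_def mem_Collect_eq
proof (intro conjI allI impI)
  fix s t :: real
  show "?z s = ?z t" if "s \<le> 0" "t \<le> 0"
    using BVspaceD(3)[OF assms(1) that] BVspaceD(3)[OF assms(2) that] by simp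
  show "?z s = ?z t" if "T < s" "T < t"
    using BVspaceD(4)[OF assms(1) that] BVspaceD(4)[OF assms(2) that] by simp
qed (auto intro!: continuous_scaleR bounded_variation_scaleR BVspaceD(1,2)[OF assms(1)] BVspaceD(1,2)[OF assms(2)])

text \<open>The closed right end makes the indicator left-continuous. Its only jump is immediately
  to the right of \<open>a\<close>, and the bounds on \<open>a\<close> keep this jump out of the two
  half-lines where constancy is required.\<close>

lemma indicator_atMost_BVspace:
  assumes "0 \<le> a" "a \<le> T"
  shows "(indicator {..a} :: real \<Rightarrow> real) \<in> BVspace T"
proof -
  let ?f = "indicator {..a} :: real \<Rightarrow> real"
  have "(?f \<longlongrightarrow> ?f t) (at_left t)" for t
  proof (rule tendsto_eventually, cases "t \<le> a")
    case True
    thus "\<forall>\<^sub>F s in at_left t. ?f s = ?f t"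
      by (auto simp: eventually_at_filter indicator_def)
  next
    case False
    have "\<forall>\<^sub>F s in at_left t. s \<in> {a<..<t}"
      using False by (intro eventually_at_left_real) auto
    thus "\<forall>\<^sub>F s in at_left t. ?f s = ?f t"
      by eventually_elim (use False in \<open>auto simp: indicator_def\<close>)
  qed
  moreover have "(\<Sum>i<n. norm (?f (s (Suc i)) - ?f (s i))) \<le> 1"
    if "\<forall>i<n. s i \<le> s (Suc i)" for n and s :: "nat \<Rightarrow> real"
  proof -
    \<comment> \<open>The indicator is nonincreasing, so its variation telescopes to the drop
      between the first and the last point.\<close>
    have "(\<Sum>i<n. norm (?f (s (Suc i)) - ?f (s i))) = (\<Sum>i<n. ?f (s i) - ?f (s (Suc i)))"
    proof (rule sum.cong)
      fix i assume "i \<in> {..<n}"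
      hence "s i \<le> s (Suc i)" using that by auto
      thus "norm (?f (s (Suc i)) - ?f (s i)) = ?f (s i) - ?f (s (Suc i))"
        by (auto simp: indicator_def)
    qed simp
    also have "\<dots> = ?f (s 0) - ?f (s n)"
      using sum_lessThan_telescope[of "\<lambda>i. - ?f (s i)" n] by simp
    also have "\<dots> \<le> 1" by (simp add: indicator_def)
    finally show ?thesis .
  qed
  ultimately show ?thesis
    using assms unfolding BVspace_def bounded_variation_def continuous_within
    by (auto intro!: exI[of _ 1])
qed

section \<open>Sets whose indicator lies in the BV space, and their density in measure\<close>

definition BV_sets :: "real \<Rightarrow> real set set" where
  "BV_sets T = {G \<in> sets borel. (indicator G :: real \<Rightarrow> real) \<in> BVspace T}"

lemma BV_sets_atMost: "0 \<le> a \<Longrightarrow> a \<le> T \<Longrightarrow> {..a} \<in> BV_sets T"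
  by (simp add: BV_sets_def indicator_atMost_BVspace)

lemma BV_sets_Compl:
  assumes "G \<in> BV_sets T" shows "- G \<in> BV_sets T"
proof -
  have "(\<lambda>t. 1 + (-1) *\<^sub>R (indicator G t :: real)) \<in> BVspace T"
    using assms by (intro BVspace_add BVspace_scaleR BVspace_const) (auto simp: BV_sets_def)
  also have "(\<lambda>t. 1 + (-1) *\<^sub>R (indicator G t :: real)) = indicator (- G)"
    by (auto simp: indicator_def)
  finally show ?thesis using assms by (auto simp: BV_sets_def)
qed

lemma BV_sets_Int:
  assumes "G \<in> BV_sets T" "H \<in> BV_sets T" shows "G \<inter> H \<in> BV_sets T"
proof -
  have "(\<lambda>t. (indicator G t :: real) *\<^sub>R (indicator H t :: real)) \<in> BVspace T"
    using assms by (intro BVspace_scaleR) (auto simp: BV_sets_def)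
  also have "(\<lambda>t. (indicator G t :: real) *\<^sub>R (indicator H t :: real)) = indicator (G \<inter> H)"
    by (auto simp: indicator_def)
  finally show ?thesis using assms by (auto simp: BV_sets_def)
qed

lemma BV_sets_UNIV: "UNIV \<in> BV_sets T"
  using BVspace_const[of "1::real" T] by (simp add: BV_sets_def indicator_def[abs_def])

lemma BV_sets_empty: "{} \<in> BV_sets T"
  using BV_sets_Compl[OF BV_sets_UNIV] by simp

lemma BV_sets_Un:
  assumes "G \<in> BV_sets T" "H \<in> BV_sets T" shows "G \<union> H \<in> BV_sets T"
  using BV_sets_Compl[OF BV_sets_Int[OF assms[THEN BV_sets_Compl]]] by simp

lemma BV_sets_UN: "(\<And>i. i < n \<Longrightarrow> G i \<in> BV_sets T) \<Longrightarrow> (\<Union>i<n. G i) \<in> BV_sets T" for n :: nat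
proof (induction n)
  case (Suc n)
  hence "G n \<union> (\<Union>i<n. G i) \<in> BV_sets T"
    by (intro BV_sets_Un Suc.IH Suc.prems) simp_all
  thus ?case by (simp add: lessThan_Suc)
qed (simp add: BV_sets_empty)

lemma BV_sets_greaterThanAtMost:
  assumes "0 \<le> a" "b \<le> T" shows "{a<..b} \<in> BV_sets T"
proof (cases "a < b")
  case True
  have "{a<..b} = - {..a} \<inter> {..b}" by auto
  moreover have "- {..a} \<inter> {..b} \<in> BV_sets T"
    using True assms by (intro BV_sets_Int BV_sets_Compl BV_sets_atMost) linarith+
  ultimately show ?thesis by simp
qed (simp add: BV_sets_empty)

text \<open>Switching between two functions is a sum of products with indicators. This is what
  \<open>BV_sets\<close> is for: a switch on a general Borel set would leave the space.\<close>

lemma BVspace_If: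
  assumes G: "G \<in> BV_sets T" and "x \<in> BVspace T" "y \<in> BVspace T"
  shows "(\<lambda>t. if t \<in> G then x t else y t) \<in> BVspace T"
proof -
  have "(\<lambda>t. (indicator G t :: real) *\<^sub>R x t + (indicator (- G) t :: real) *\<^sub>R y t) \<in> BVspace T"
    using assms BV_sets_Compl[OF G] by (intro BVspace_add BVspace_scaleR) (auto simp: BV_sets_def)
  also have "(\<lambda>t. (indicator G t :: real) *\<^sub>R x t + (indicator (- G) t :: real) *\<^sub>R y t)
      = (\<lambda>t. if t \<in> G then x t else y t)"
    by (auto simp: indicator_def)
  finally show ?thesis .
qed

text \<open>\<open>BV_sets T\<close> is an algebra, and on \<open>[0,T]\<close> it contains the
  half-lines that generate the Borel sets. Approximability passes to complements, and to countable
  unions because finiteness of the measure makes the tail of a union small.\<close>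

lemma BV_sets_approx:
  fixes \<nu> :: "real measure"
  assumes T: "T > 0" and fin: "finite_measure \<nu>"
    and sets: "sets \<nu> = sets (restrict_space borel {0..T})"
    and E: "E \<in> sets \<nu>" and e: "e > 0"
  shows "\<exists>G\<in>BV_sets T. measure \<nu> (sym_diff E (G \<inter> {0..T})) < e"
proof -
  interpret finite_measure \<nu> by (rule fin)
  have m[simp]: "B \<inter> {0..T} \<in> sets \<nu>" if "B \<in> sets borel" for B
    using that unfolding sets sets_restrict_space by (auto simp: Int_commute)
  have mG: "G \<in> sets borel" if "G \<in> BV_sets T" for G
    using that by (simp add: BV_sets_def)
  have "\<exists>G\<in>BV_sets T. measure \<nu> (sym_diff B G \<inter> {0..T}) < e"
    if "B \<in> sigma_sets UNIV (range (\<lambda>a::real. {..a}))" "e > 0" for B e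
    using that
  proof (induction arbitrary: e)
    case (Basic B)
    then obtain a where B: "B = {..a}" by auto
    \<comment> \<open>A half-line with end point outside \<open>[0,T]\<close> agrees on
      \<open>[0,T]\<close> with the empty set or the whole line.\<close>
    consider "a < 0" | "a > T" | "0 \<le> a" "a \<le> T" by linarith
    thus ?case
    proof cases
      case 1
      hence "sym_diff B {} \<inter> {0..T} = {}" by (auto simp: B)
      thus ?thesis using Basic BV_sets_empty by (metis measure_empty)
    next
      case 2
      hence "sym_diff B UNIV \<inter> {0..T} = {}" by (auto simp: B)
      thus ?thesis using Basic BV_sets_UNIV by (metis measure_empty)
    next
      case 3
      hence "B \<in> BV_sets T" by (simp add: B BV_sets_atMost)
      thus ?thesis using Basic by (intro bexI[of _ B]) auto
    qed
  next
    case Empty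
    thus ?case using BV_sets_empty by (intro bexI[of _ "{}"]) auto
  next
    case (Compl B)
    then obtain G where G: "G \<in> BV_sets T" "measure \<nu> (sym_diff B G \<inter> {0..T}) < e" by blast
    have "sym_diff (UNIV - B) (- G) = sym_diff B G" by auto
    thus ?case using G BV_sets_Compl by metis
  next
    case (Union B)
    have B: "B i \<in> sets borel" for i
      using Union(1)[of i] by (simp add: borel_eq_atMost)
    \<comment> \<open>The part of the union missed by the first \<open>n\<close> sets; it decreases
      to the empty set.\<close>
    let ?R = "\<lambda>n. ((\<Union>i. B i) - (\<Union>i<n. B i)) \<inter> {0..T}"
    have "(\<lambda>n. measure \<nu> (?R n)) \<longlonglongrightarrow> measure \<nu> (\<Inter>n. ?R n)"
      using B by (intro finite_Lim_measure_decseq) (auto simp: decseq_def intro!: m)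
    moreover have "(\<Inter>n. ?R n) = {}" by auto
    ultimately have "(\<lambda>n. measure \<nu> (?R n)) \<longlonglongrightarrow> 0" by simp
    hence "\<forall>\<^sub>F n in sequentially. measure \<nu> (?R n) < e / 2"
      using \<open>e > 0\<close> by (intro order_tendstoD) auto
    then obtain n where n: "measure \<nu> (?R n) < e / 2"
      unfolding eventually_sequentially by blast
    \<comment> \<open>The tail uses up \<open>e / 2\<close>, and the \<open>n\<close> remaining
      errors together stay below the other half; \<open>Suc n\<close> avoids division by
      zero.\<close>
    have "\<forall>i. \<exists>G\<in>BV_sets T. measure \<nu> (sym_diff (B i) G \<inter> {0..T}) < e / (2 * Suc n)"
      using Union.IH \<open>e > 0\<close> by simp
    then obtain G where G: "\<And>i. G i \<in> BV_sets T"
        "\<And>i. measure \<nu> (sym_diff (B i) (G i) \<inter> {0..T}) < e / (2 * Suc n)"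
      by metis
    let ?D = "\<lambda>i. sym_diff (B i) (G i) \<inter> {0..T}"
    have D: "?D i \<in> sets \<nu>" for i
      using B mG[OF G(1)] by (intro m) auto
    have R: "?R n \<in> sets \<nu>"
      using B by (intro m) auto
    have "measure \<nu> (sym_diff (\<Union>i. B i) (\<Union>i<n. G i) \<inter> {0..T}) \<le> measure \<nu> (?R n \<union> (\<Union>i<n. ?D i))"
      using D R by (intro finite_measure_mono sets.Un sets.finite_UN) auto
    also have "\<dots> \<le> measure \<nu> (?R n) + measure \<nu> (\<Union>i<n. ?D i)"
      using D R by (intro measure_Un_le sets.finite_UN) auto
    also have "\<dots> \<le> measure \<nu> (?R n) + (\<Sum>i<n. measure \<nu> (?D i))"
      using D by (intro add_left_mono measure_UNION_le) auto
    also have "(\<Sum>i<n. measure \<nu> (?D i)) \<le> (\<Sum>i<n. e / (2 * Suc n))"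
      using G(2) by (intro sum_mono less_imp_le)
    also have "\<dots> \<le> e / 2"
      using \<open>e > 0\<close> by (simp add: field_simps)
    finally have "measure \<nu> (sym_diff (\<Union>i. B i) (\<Union>i<n. G i) \<inter> {0..T}) < e"
      using n by simp
    thus ?case
      using G(1) by (intro bexI[of _ "\<Union>i<n. G i"] BV_sets_UN)
  qed
  moreover obtain B where "B \<in> sets borel" "E = B \<inter> {0..T}"
    using E unfolding sets sets_restrict_space by auto
  ultimately obtain G where "G \<in> BV_sets T" "measure \<nu> (sym_diff B G \<inter> {0..T}) < e"
    using e by (auto simp: borel_eq_atMost)
  moreover have "sym_diff B G \<inter> {0..T} = sym_diff E (G \<inter> {0..T})"
    by (auto simp: \<open>E = _\<close>)
  ultimately show ?thesis by auto
qed

subsection \<open>Convex sets and normal integrands\<close>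

text \<open>The balls surround the vertices of a cross-polytope, and \<open>C\<close> need only meet
  them, which is all that inner semicontinuity can provide. Put
  \<open>r = \<rho> / (4 * DIM('a))\<close>. If a functional \<open>a\<close> separated
  \<open>q\<close> from \<open>C\<close>, moving from \<open>v\<close> to a suitable vertex would
  lower it by at least \<open>4 * r * norm a\<close>. The displacements of the point of
  \<open>C\<close> from the vertex and of \<open>q\<close> from \<open>v\<close> cost at most
  \<open>r * norm a\<close> each, a contradiction.\<close>

lemma convex_cball_subset:
  fixes C :: "'a::euclidean_space set"
  assumes C: "convex C" and \<rho>: "\<rho> > 0"
    and meets: "\<And>b \<sigma>. b \<in> Basis \<Longrightarrow> \<sigma> \<in> {-1, 1} \<Longrightarrow>
      C \<inter> ball (v + (\<sigma> * \<rho>) *\<^sub>R b) (\<rho> / (4 * DIM('a))) \<noteq> {}"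
  shows "cball v (\<rho> / (4 * DIM('a))) \<subseteq> C"
proof
  fix q assume "q \<in> cball v (\<rho> / (4 * DIM('a)))"
  define r where "r = \<rho> / (4 * DIM('a))"
  have r: "r > 0" "\<rho> = 4 * DIM('a) * r" using \<rho> by (auto simp: r_def)
  have q: "norm (q - v) \<le> r"
    using \<open>q \<in> _\<close> by (simp add: dist_norm norm_minus_commute r_def)
  obtain b0 :: 'a where "b0 \<in> Basis" using nonempty_Basis by blast
  hence "C \<noteq> {}" using meets[of b0 1] by auto
  show "q \<in> C"
  proof (rule ccontr)
    assume "q \<notin> C"
    then obtain a c where a: "a \<noteq> 0" "inner a q \<le> c" "\<And>x. x \<in> C \<Longrightarrow> inner a x \<ge> c"
      using separating_hyperplane_sets[of "{q}" C] C \<open>C \<noteq> {}\<close> by auto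
    \<comment> \<open>The norm is at most the sum of the absolute coordinates, so one coordinate
      carries at least the average share.\<close>
    have "\<exists>b\<in>Basis. norm a \<le> DIM('a) * \<bar>inner a b\<bar>"
    proof (rule ccontr)
      assume "\<not> ?thesis"
      hence "(\<Sum>b\<in>(Basis::'a set). DIM('a) * \<bar>inner a b\<bar>) < (\<Sum>b\<in>(Basis::'a set). norm a)"
        by (intro sum_strict_mono) auto
      hence "DIM('a) * (\<Sum>b\<in>(Basis::'a set). \<bar>inner a b\<bar>) < DIM('a) * norm a"
        by (simp add: sum_distrib_left)
      thus False using norm_le_l1[of a] by simp
    qed
    then obtain b where b: "b \<in> Basis" "norm a \<le> DIM('a) * \<bar>inner a b\<bar>" by blast
    \<comment> \<open>The sign selects the vertex on which the functional is small.\<close>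
    define \<sigma> :: real where "\<sigma> = (if inner a b \<ge> 0 then -1 else 1)"
    have \<sigma>: "\<sigma> \<in> {-1, 1}" "\<sigma> * inner a b = - \<bar>inner a b\<bar>" by (auto simp: \<sigma>_def)
    obtain y where y: "y \<in> C" "norm (y - (v + (\<sigma> * \<rho>) *\<^sub>R b)) < r"
      using meets[OF b(1) \<sigma>(1)] by (auto simp: dist_norm norm_minus_commute r_def)
    define w where "w = y - (v + (\<sigma> * \<rho>) *\<^sub>R b)"
    have "y = v + (\<sigma> * \<rho>) *\<^sub>R b + w" by (simp add: w_def)
    hence "inner a y = inner a v + \<rho> * (\<sigma> * inner a b) + inner a w"
      by (simp add: inner_add_right)
    hence "inner a y = inner a v - \<rho> * \<bar>inner a b\<bar> + inner a w"
      using \<sigma>(2) by simp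
    moreover have "inner a w \<le> norm a * r"
      using norm_cauchy_schwarz[of a w] y(2) mult_left_mono[of "norm w" r "norm a"]
      by (simp add: w_def)
    moreover have "4 * r * norm a \<le> \<rho> * \<bar>inner a b\<bar>"
      using mult_left_mono[OF b(2), of "4 * r"] r by (simp add: mult_ac)
    ultimately have "inner a y \<le> inner a v - 3 * (r * norm a)"
      by (simp add: algebra_simps)
    moreover have "inner a v - inner a q \<le> norm a * r"
      using norm_cauchy_schwarz[of a "v - q"] q mult_left_mono[of "norm (q - v)" r "norm a"]
      by (simp add: norm_minus_commute inner_diff_right)
    moreover have "inner a q \<le> inner a y" using a y by force
    moreover have "r * norm a > 0" using r a by simp
    ultimately show False by (simp add: mult.commute)
  qed
qed

lemma convex_cball_subset_vertices:
  fixes C :: "'a::euclidean_space set"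
  assumes "convex C" "\<rho> > 0" "\<And>b \<sigma>. b \<in> Basis \<Longrightarrow> \<sigma> \<in> {-1, 1} \<Longrightarrow> v + (\<sigma> * \<rho>) *\<^sub>R b \<in> C"
  shows "cball v (\<rho> / (4 * DIM('a))) \<subseteq> C"
proof (rule convex_cball_subset[OF assms(1,2)])
  fix b :: 'a and \<sigma> :: real assume *: "b \<in> Basis" "\<sigma> \<in> {-1, 1}"
  have "v + (\<sigma> * \<rho>) *\<^sub>R b \<in> C \<inter> ball (v + (\<sigma> * \<rho>) *\<^sub>R b) (\<rho> / (4 * DIM('a)))"
    using assms(3)[OF *] \<open>\<rho> > 0\<close> by (auto intro!: divide_pos_pos mult_pos_pos)
  thus "C \<inter> ball (v + (\<sigma> * \<rho>) *\<^sub>R b) (\<rho> / (4 * DIM('a))) \<noteq> {}" by blast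
qed

lemma vertex_mem_cball:
  fixes v :: "'a::euclidean_space"
  assumes "b \<in> Basis" "\<sigma> \<in> {-1, 1}" "\<rho> > 0"
  shows "v + (\<sigma> * \<rho>) *\<^sub>R b \<in> cball v \<rho>"
  using assms by (auto simp: dist_norm)

lemma convex_sublevel:
  assumes "convex (epi f)"
  shows "convex {x. f x \<le> ereal \<alpha>}"
proof (rule convexI)
  fix x y u v assume *: "x \<in> {x. f x \<le> ereal \<alpha>}" "y \<in> {x. f x \<le> ereal \<alpha>}"
    "0 \<le> u" "0 \<le> v" "u + v = (1::real)"
  have "u *\<^sub>R (x, \<alpha>) + v *\<^sub>R (y, \<alpha>) \<in> epi f"
    using * by (intro convexD[OF assms]) (auto simp: epi_def)
  also have "u *\<^sub>R (x, \<alpha>) + v *\<^sub>R (y, \<alpha>) = (u *\<^sub>R x + v *\<^sub>R y, \<alpha>)"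
    using * by (simp flip: distrib_right)
  finally show "u *\<^sub>R x + v *\<^sub>R y \<in> {x. f x \<le> ereal \<alpha>}" by (simp add: epi_def)
qed

lemma edom_eq_fst_epi: "edom f = fst ` epi f"
proof -
  have "\<exists>\<alpha>. f x \<le> ereal \<alpha>" if "f x < \<infinity>" for x
    using that by (cases "f x") auto
  thus ?thesis by (force simp: edom_def epi_def image_iff)
qed

lemma convex_edom: "convex (epi f) \<Longrightarrow> convex (edom f)"
  unfolding edom_eq_fst_epi by (intro convex_linear_image) (auto simp: linear_iff)

text \<open>A common bound at the finitely many cross-polytope vertices puts them into one sublevel
  set, which is convex and therefore contains the smaller ball.\<close>

lemma bounded_on_cball:
  fixes f :: "'a::euclidean_space \<Rightarrow> ereal"
  assumes cvx: "convex (epi f)" and \<rho>: "\<rho> > 0" and sub: "cball x \<rho> \<subseteq> edom f"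
  shows "\<exists>M. \<forall>u\<in>cball x (\<rho> / (4 * DIM('a))). f u \<le> ereal M"
proof -
  let ?V = "(\<lambda>q. x + (snd q * \<rho>) *\<^sub>R fst q) ` ((Basis :: 'a set) \<times> {-1, 1})"
  define M where "M = Max ((\<lambda>p. real_of_ereal (f p)) ` ?V)"
  have fin: "finite ?V" by simp
  have V: "f p \<le> ereal M" if "p \<in> ?V" for p
  proof -
    obtain q where q: "p = x + (snd q * \<rho>) *\<^sub>R fst q" "q \<in> Basis \<times> {-1, 1}"
      using \<open>p \<in> ?V\<close> by (rule imageE)
    hence "p \<in> cball x \<rho>"
      unfolding q(1) by (intro vertex_mem_cball \<rho>) auto
    hence "p \<in> edom f" using sub by blast
    \<comment> \<open>At a value -\<infinity> the default 0 of \<open>real_of_ereal\<close> is still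
      an upper bound.\<close>
    hence "f p \<le> ereal (real_of_ereal (f p))" by (cases "f p") (auto simp: edom_def)
    also have "real_of_ereal (f p) \<le> M"
      unfolding M_def by (intro Max_ge finite_imageI[OF fin] imageI[OF that])
    finally show ?thesis by simp
  qed
  have "cball x (\<rho> / (4 * DIM('a))) \<subseteq> {u. f u \<le> ereal M}"
  proof (rule convex_cball_subset_vertices[OF convex_sublevel[OF cvx] \<rho>])
    fix b :: 'a and \<sigma> :: real assume "b \<in> Basis" "\<sigma> \<in> {-1, 1}"
    hence "x + (\<sigma> * \<rho>) *\<^sub>R b \<in> ?V"
      by (intro image_eqI[of _ _ "(b, \<sigma>)"]) auto
    from V[OF this] show "x + (\<sigma> * \<rho>) *\<^sub>R b \<in> {u. f u \<le> ereal M}" by simp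
  qed
  thus ?thesis by auto
qed

text \<open>Sliding a near-minimiser slightly towards an interior point keeps the value small on a whole
  ball, so values on a dense set determine the infimum.\<close>
lemma exists_dense_near_inf:
  fixes f :: "'a::euclidean_space \<Rightarrow> ereal"
  assumes cvx: "convex (epi f)" and \<rho>: "\<rho> > 0" and sub: "cball x \<rho> \<subseteq> edom f"
    and not_MInf: "\<And>v. f v \<noteq> -\<infinity>"
    and dense: "\<And>U. open U \<Longrightarrow> U \<noteq> {} \<Longrightarrow> \<exists>d\<in>Q. d \<in> U"
    and c: "(INF v. f v) < c"
  shows "\<exists>v\<in>Q. \<exists>r>0. cball v r \<subseteq> edom f \<and> f v < c"
proof -
  define r where "r = \<rho> / (4 * DIM('a))"
  have r: "r > 0" using \<rho> by (simp add: r_def)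
  obtain M where M: "\<And>u. u \<in> cball x r \<Longrightarrow> f u \<le> ereal M"
    using bounded_on_cball[OF cvx \<rho> sub] unfolding r_def by blast
  obtain w where w: "f w < c" using c by (auto simp: INF_less_iff)
  obtain \<alpha> where \<alpha>: "f w = ereal \<alpha>" using w not_MInf[of w] by (cases "f w") auto
  obtain \<beta> where \<beta>: "\<alpha> < \<beta>" "ereal \<beta> < c"
    using w unfolding \<alpha> by (metis ereal_dense2 ereal_less(2) less_ereal.simps(1) less_trans)
  \<comment> \<open>Convexity will bound \<open>f\<close> near
    \<open>(1 - l) *\<^sub>R w + l *\<^sub>R x\<close> by this expression, which is below
    \<open>\<beta>\<close> for small \<open>l\<close>.\<close>
  have "((\<lambda>l. (1 - l) * \<alpha> + l * M) \<longlongrightarrow> (1 - 0) * \<alpha> + 0 * M) (at_right 0)"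
    by (intro tendsto_intros)
  hence "\<forall>\<^sub>F l in at_right 0. (1 - l) * \<alpha> + l * M < \<beta>"
    using \<beta>(1) by (intro order_tendstoD) auto
  moreover have "\<forall>\<^sub>F l in at_right 0. l \<in> {0<..<(1::real)}"
    by (intro eventually_at_right_real) auto
  ultimately have "\<forall>\<^sub>F l in at_right 0. (1 - l) * \<alpha> + l * M < \<beta> \<and> l \<in> {0<..<(1::real)}"
    by (rule eventually_conj)
  then obtain l where l: "(1 - l) * \<alpha> + l * M < \<beta>" "0 < l" "l < 1"
    using eventually_happens'[OF trivial_limit_at_right_real] by fastforce
  define m where "m = (1 - l) *\<^sub>R w + l *\<^sub>R x"
  have small: "f y < c" if "y \<in> cball m (l * r)" for y
  proof -
    \<comment> \<open>The solution of \<open>y = (1 - l) *\<^sub>R w + l *\<^sub>R u\<close>; the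
      radius \<open>l * r\<close> around \<open>m\<close> corresponds to the radius \<open>r\<close>
      around \<open>x\<close>.\<close>
    define u where "u = x + (1 / l) *\<^sub>R (y - m)"
    have "norm (y - m) \<le> l * r" using that by (simp add: dist_norm norm_minus_commute)
    moreover have "norm (u - x) = norm (y - m) / l" using l by (simp add: u_def)
    ultimately have "norm (u - x) \<le> r" using l by (simp add: pos_divide_le_eq mult.commute)
    hence "u \<in> cball x r" by (simp add: dist_norm norm_minus_commute)
    hence "(u, M) \<in> epi f" using M by (simp add: epi_def)
    moreover have "(w, \<alpha>) \<in> epi f" by (simp add: epi_def \<alpha>)
    ultimately have "(1 - l) *\<^sub>R (w, \<alpha>) + l *\<^sub>R (u, M) \<in> epi f"
      using l by (intro convexD[OF cvx]) auto
    moreover have "(1 - l) *\<^sub>R w + l *\<^sub>R u = y"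
      using l by (simp add: u_def m_def scaleR_add_right)
    ultimately have "f y \<le> ereal ((1 - l) * \<alpha> + l * M)" by (simp add: epi_def)
    also have "\<dots> < ereal \<beta>" using l(1) by simp
    also note \<beta>(2)
    finally show ?thesis .
  qed
  \<comment> \<open>Half the radius is kept in reserve, so that a whole ball around \<open>v\<close>
    remains in the region where \<open>f\<close> is below \<open>c\<close>.\<close>
  obtain v where v: "v \<in> Q" "v \<in> ball m (l * r / 2)"
    using dense[of "ball m (l * r / 2)"] l r by (metis open_ball centre_in_ball empty_iff half_gt_zero mult_pos_pos)
  have "f y < \<infinity>" if "y \<in> cball v (l * r / 2)" for y
  proof (rule less_le_trans[OF small])
    show "y \<in> cball m (l * r)"
      using dist_triangle[of m y v] v(2) that by simp
  qed simp
  hence "cball v (l * r / 2) \<subseteq> edom f"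
    unfolding edom_def by blast
  moreover have "f v < c"
  proof (rule small)
    show "v \<in> cball m (l * r)" using v(2) mult_pos_pos[OF l(2) r] by simp
  qed
  ultimately show ?thesis
    using v(1) l r by (intro bexI[of _ v] exI[of _ "l * r / 2"] conjI) simp_all
qed

section \<open>Left-inner semicontinuity as persistence on left intervals\<close>

lemma tau_open_left_interval:
  assumes "tau_open T U" "t \<in> U"
  shows "\<exists>s<t. \<forall>r\<in>{s<..t}. r \<in> {0..T} \<longrightarrow> r \<in> U"
proof -
  obtain V where V: "generate_topology (range (\<lambda>(s,t). {s<..t})) V" "U = V \<inter> {0..T}"
    using assms unfolding tau_open_def by blast
  \<comment> \<open>Proved on the whole line and for every point, so that the induction over
    generated open sets goes through; an intersection takes the larger of the two left ends.\<close>
  have "\<exists>s<t. {s<..t} \<subseteq> V" if "t \<in> V" for t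
    using V(1) that
  proof (induction arbitrary: t)
    case UNIV
    thus ?case by (auto intro: lt_ex)
  next
    case (Int A B)
    then obtain s s' where "s < t" "{s<..t} \<subseteq> A" "s' < t" "{s'<..t} \<subseteq> B" by blast
    thus ?case by (intro exI[of _ "max s s'"]) auto
  next
    case (UN K)
    thus ?case by blast
  next
    case (Basis A)
    then obtain a b where "A = {a<..b}" by auto
    thus ?case using \<open>t \<in> A\<close> by (intro exI[of _ a]) (simp add: subset_eq)
  qed
  then obtain s where "s < t" "{s<..t} \<subseteq> V" using assms(2) V(2) by blast
  thus ?thesis unfolding V(2) by blast
qed

text \<open>At \<open>t\<close> the set contains all cross-polytope vertices, so it meets the
  finitely many open balls around them. Semicontinuity keeps each of these meetings on a left
  interval, and convexity recovers a smaller ball on their intersection.\<close>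

lemma lisc_cball:
  fixes S :: "real \<Rightarrow> 'a::euclidean_space set"
  assumes lisc: "left_inner_semicontinuous T S"
    and cvx: "\<And>t. t \<in> {0..T} \<Longrightarrow> convex (S t)"
    and t: "t \<in> {0..T}" and \<rho>: "\<rho> > 0" and sub: "cball v \<rho> \<subseteq> S t"
  shows "\<exists>s<t. \<forall>r\<in>{s<..t}. r \<in> {0..T} \<longrightarrow> cball v (\<rho> / (4 * DIM('a))) \<subseteq> S r"
proof -
  let ?P = "(Basis :: 'a set) \<times> {-1, 1 :: real}"
  let ?B = "\<lambda>(b, \<sigma>). ball (v + (\<sigma> * \<rho>) *\<^sub>R b) (\<rho> / (4 * DIM('a)))"
  have "\<exists>s<t. \<forall>r\<in>{s<..t}. r \<in> {0..T} \<longrightarrow> S r \<inter> ?B p \<noteq> {}" if p: "p \<in> ?P" for p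
  proof -
    obtain b \<sigma> where [simp]: "p = (b, \<sigma>)" by (cases p)
    have "v + (\<sigma> * \<rho>) *\<^sub>R b \<in> S t"
      using p sub vertex_mem_cball[OF _ _ \<rho>, of b \<sigma> v] by auto
    moreover have "v + (\<sigma> * \<rho>) *\<^sub>R b \<in> ?B p" using \<rho> by simp
    ultimately have "t \<in> {t\<in>{0..T}. S t \<inter> ?B p \<noteq> {}}" using t by blast
    moreover have "tau_open T {t\<in>{0..T}. S t \<inter> ?B p \<noteq> {}}"
      using lisc unfolding left_inner_semicontinuous_def by simp
    ultimately show ?thesis using tau_open_left_interval by blast
  qed
  then obtain s where s: "\<And>p. p \<in> ?P \<Longrightarrow> s p < t"
      "\<And>p r. p \<in> ?P \<Longrightarrow> r \<in> {s p<..t} \<Longrightarrow> r \<in> {0..T} \<Longrightarrow> S r \<inter> ?B p \<noteq> {}"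
    by metis
  have fin: "finite (s ` ?P)" and ne: "s ` ?P \<noteq> {}" by auto
  define m where "m = Max (s ` ?P)"
  have "m < t" unfolding m_def using s(1) fin ne by (subst Max_less_iff) auto
  moreover have "cball v (\<rho> / (4 * DIM('a))) \<subseteq> S r"
    if r: "r \<in> {m<..t}" "r \<in> {0..T}" for r
  proof (rule convex_cball_subset[OF cvx[OF r(2)] \<rho>])
    fix b :: 'a and \<sigma> :: real assume "b \<in> Basis" "\<sigma> \<in> {-1, 1}"
    hence p: "(b, \<sigma>) \<in> ?P" by simp
    hence "s (b, \<sigma>) \<le> m" unfolding m_def using fin by (intro Max_ge) auto
    hence "r \<in> {s (b, \<sigma>)<..t}" using r(1) by simp
    from s(2)[OF p this r(2)]
    show "S r \<inter> ball (v + (\<sigma> * \<rho>) *\<^sub>R b) (\<rho> / (4 * DIM('a))) \<noteq> {}" by simp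
  qed
  ultimately show ?thesis by blast
qed

text \<open>The inequality \<open>h t (x t) \<le> ereal \<alpha>\<close> says that the moving point
  \<open>(x t, \<alpha>)\<close> lies in the closed set \<open>epi (h t)\<close>. Normality only
  measures hitting of fixed open sets, so the point is located by countably many small boxes with
  dense centres.\<close>

lemma normal_integrand_measurable:
  fixes h :: "real \<Rightarrow> 'a::euclidean_space \<Rightarrow> ereal"
  assumes h: "convex_normal_integrand T h"
    and sp: "space \<mu> = {0..T}" and sets: "sets \<mu> = sets (restrict_space borel {0..T})"
    and x[measurable]: "x \<in> borel_measurable \<mu>"
  shows "(\<lambda>t. h t (x t)) \<in> borel_measurable \<mu>"
proof -
  obtain Q :: "'a set" where Q: "countable Q" "\<And>U. open U \<Longrightarrow> U \<noteq> {} \<Longrightarrow> \<exists>d\<in>Q. d \<in> U"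
    using countable_dense_setE by blast
  have meas: "{t\<in>{0..T}. epi (h t) \<inter> G \<noteq> {}} \<in> sets \<mu>" if "open G" for G
  proof -
    have "{t\<in>{0..T}. epi (h t) \<inter> G \<noteq> {}} \<in> sets borel"
      using h that unfolding convex_normal_integrand_def by blast
    thus ?thesis unfolding sets by (auto simp: sets_restrict_space_iff)
  qed
  have le: "{t\<in>{0..T}. h t (x t) \<le> ereal \<alpha>} \<in> sets \<mu>" for \<alpha>
  proof -
    define A where "A = (\<lambda>n q. {t\<in>{0..T}. dist (x t) q < 1 / Suc n} \<inter>
      {t\<in>{0..T}. epi (h t) \<inter> (ball q (1 / Suc n) \<times> ball \<alpha> (1 / Suc n)) \<noteq> {}})"
    have A: "A n q \<in> sets \<mu>" for n q
      unfolding A_def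
    proof (rule sets.Int)
      have "{t\<in>space \<mu>. dist (x t) q < 1 / Suc n} \<in> sets \<mu>" by measurable
      thus "{t\<in>{0..T}. dist (x t) q < 1 / Suc n} \<in> sets \<mu>" by (simp add: sp)
    qed (intro meas open_Times, auto)
    have "t \<in> (\<Inter>n. \<Union>q\<in>Q. A n q) \<longleftrightarrow> h t (x t) \<le> ereal \<alpha>" if t: "t \<in> {0..T}" for t
    proof
      assume L: "t \<in> (\<Inter>n. \<Union>q\<in>Q. A n q)"
      have "(x t, \<alpha>) \<in> closure (epi (h t))"
      proof (subst closure_approachable, intro allI impI)
        fix e :: real assume "e > 0"
        \<comment> \<open>Three distances add up: from \<open>x t\<close> to \<open>q\<close>, from
          \<open>q\<close> to \<open>y\<close>, and from \<open>\<alpha>\<close> to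
          \<open>\<beta>\<close>.\<close>
        obtain n where n: "1 / Suc n < e / 3"
          using nat_approx_posE[of "e / 3"] \<open>e > 0\<close> by auto
        have "t \<in> (\<Union>q\<in>Q. A n q)" using L by (rule INT_D) simp
        then obtain q where "t \<in> A n q" by (elim UN_E)
        then obtain y \<beta> where y: "dist (x t) q < 1 / Suc n" "(y, \<beta>) \<in> epi (h t)"
            "dist q y < 1 / Suc n" "dist \<alpha> \<beta> < 1 / Suc n"
          unfolding A_def by auto
        have "dist (y, \<beta>) (x t, \<alpha>) \<le> dist y (x t) + dist \<beta> \<alpha>"
          unfolding dist_prod_def fst_conv snd_conv by (rule sqrt_sum_squares_le_sum) auto
        also have "dist y (x t) \<le> dist (x t) q + dist q y"
          by (metis dist_commute dist_triangle)
        finally have "dist (y, \<beta>) (x t, \<alpha>) < e"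
          using y(1,3,4) n by (simp add: dist_commute)
        thus "\<exists>z\<in>epi (h t). dist z (x t, \<alpha>) < e" using y(2) by blast
      qed
      moreover have "closed (epi (h t))"
        using h t unfolding convex_normal_integrand_def by blast
      ultimately show "h t (x t) \<le> ereal \<alpha>" by (simp add: epi_def)
    next
      assume R: "h t (x t) \<le> ereal \<alpha>"
      have "\<exists>q\<in>Q. t \<in> A n q" for n
      proof -
        obtain q where q: "q \<in> Q" "q \<in> ball (x t) (1 / Suc n)"
          using Q(2)[of "ball (x t) (1 / Suc n)"] by auto
        have "(x t, \<alpha>) \<in> epi (h t) \<inter> (ball q (1 / Suc n) \<times> ball \<alpha> (1 / Suc n))"
          using R q by (auto simp: epi_def dist_commute)
        moreover have "dist (x t) q < 1 / Suc n" using q(2) by simp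
        ultimately have "t \<in> A n q" using t unfolding A_def by blast
        thus ?thesis using q(1) by blast
      qed
      thus "t \<in> (\<Inter>n. \<Union>q\<in>Q. A n q)" by (intro INT_I UN_iff[THEN iffD2])
    qed
    moreover have "(\<Inter>n. \<Union>q\<in>Q. A n q) \<subseteq> {0..T}" by (auto simp: A_def)
    ultimately have "{t\<in>{0..T}. h t (x t) \<le> ereal \<alpha>} = (\<Inter>n. \<Union>q\<in>Q. A n q)" by blast
    also have "\<dots> \<in> sets \<mu>"
      using Q(1) A by (intro sets.countable_INT) (auto intro!: sets.countable_UN')
    finally show ?thesis .
  qed
  have neq: "h t (x t) \<noteq> -\<infinity>" if "t \<in> {0..T}" for t
    using h that unfolding convex_normal_integrand_def by blast
  show ?thesis
    unfolding borel_measurable_iff_Iic_ereal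
  proof
    fix a :: ereal
    show "(\<lambda>t. h t (x t)) -` {..a} \<inter> space \<mu> \<in> sets \<mu>"
    proof (cases a)
      case (real \<alpha>)
      thus ?thesis using le[of \<alpha>] by (simp add: sp vimage_def Int_def conj_commute)
    next
      case PInf
      hence "{..a} = UNIV" by auto
      thus ?thesis by simp
    next
      case MInf
      hence "(\<lambda>t. h t (x t)) -` {..a} \<inter> space \<mu> = {}" using neq sp by auto
      thus ?thesis by simp
    qed
  qed
qed

subsection \<open>Margins and extended integrals\<close>

text \<open>Assign to each exceptional \<open>t\<close> a rational \<open>q t\<close> with
  \<open>W (q t) t\<close>. If \<open>t < u\<close> shared this rational, then the interval from it
  to a rational between \<open>t\<close> and \<open>u\<close> would cover \<open>t\<close>; so the
  assignment is injective.\<close>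

lemma countable_not_covered:
  fixes W :: "real \<Rightarrow> real \<Rightarrow> bool"
  assumes mono: "\<And>a b a' b'. W a b \<Longrightarrow> a \<le> a' \<Longrightarrow> b' \<le> b \<Longrightarrow> W a' b'"
  shows "countable {t\<in>{0<..T}. (\<exists>s<t. 0 \<le> s \<and> W s t) \<and>
    \<not> (\<exists>a\<in>\<rat>. \<exists>b\<in>\<rat>. 0 \<le> a \<and> b \<le> T \<and> t \<in> {a<..b} \<and> W a b)}"
proof -
  define C where "C t \<longleftrightarrow> (\<exists>a\<in>\<rat>. \<exists>b\<in>\<rat>. 0 \<le> a \<and> b \<le> T \<and> t \<in> {a<..b} \<and> W a b)" for t
  define N where "N = {t\<in>{0<..T}. (\<exists>s<t. 0 \<le> s \<and> W s t) \<and> \<not> C t}"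
  have "\<exists>q. q \<in> \<rat> \<and> 0 \<le> q \<and> q < t \<and> W q t" if "t \<in> N" for t
  proof -
    obtain s where s: "s < t" "0 \<le> s" "W s t" using \<open>t \<in> N\<close> unfolding N_def by blast
    obtain q where "q \<in> \<rat>" "s < q" "q < t" using Rats_dense_in_real[OF s(1)] by blast
    thus ?thesis using s mono[OF s(3), of q t] by (intro exI[of _ q]) auto
  qed
  then obtain q where q: "\<And>t. t \<in> N \<Longrightarrow> q t \<in> \<rat> \<and> 0 \<le> q t \<and> q t < t \<and> W (q t) t"
    by metis
  have neq: "q t \<noteq> q u" if t: "t \<in> N" and u: "u \<in> N" and "t < u" for t u
  proof
    assume eq: "q t = q u"
    obtain b where b: "b \<in> \<rat>" "t < b" "b < u" using Rats_dense_in_real[OF \<open>t < u\<close>] by blast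
    have "W (q t) b" using q[OF u] b mono[of "q u" u "q t" b] eq by simp
    moreover have "b \<le> T" using u b by (simp add: N_def)
    ultimately have "C t"
      using q[OF t] b unfolding C_def by (intro bexI[of _ "q t"] bexI[of _ b]) auto
    thus False using t by (simp add: N_def)
  qed
  have "inj_on q N"
  proof (rule inj_onI, rule ccontr)
    fix t u assume *: "t \<in> N" "u \<in> N" "q t = q u" "t \<noteq> u"
    thus False using neq[of t u] neq[of u t] by (metis linorder_less_linear)
  qed
  moreover have "countable (q ` N)"
    by (rule countable_subset[OF _ countable_rat]) (use q in blast)
  ultimately have "countable N" by (rule countable_image_inj_on[rotated])
  thus ?thesis unfolding N_def C_def .
qed

text \<open>For convex-valued \<open>S\<close> this is equivalent to \<open>in_int_Linf\<close>, by
  the next two lemmas. A uniform radius checked separately at each \<open>t\<close> is easier to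
  patch than a quantification over all nearby selections.\<close>

definition has_margin :: "real measure \<Rightarrow> (real \<Rightarrow> 'a::euclidean_space set) \<Rightarrow> (real \<Rightarrow> 'a) \<Rightarrow> bool" where
  "has_margin \<mu> S x \<longleftrightarrow> x \<in> borel_measurable \<mu> \<and> (\<exists>B. AE t in \<mu>. norm (x t) \<le> B) \<and>
     (\<exists>\<rho>>0. AE t in \<mu>. cball (x t) \<rho> \<subseteq> S t)"

lemma has_margin_imp_in_int:
  assumes "has_margin \<mu> S x"
  shows "in_int_Linf \<mu> S x"
proof -
  obtain \<rho> where \<rho>: "\<rho> > 0" "AE t in \<mu>. cball (x t) \<rho> \<subseteq> S t"
    using assms unfolding has_margin_def by blast
  have "AE t in \<mu>. y t \<in> S t" if "AE t in \<mu>. norm (y t - x t) \<le> \<rho>" for y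
    using that \<rho>(2)
  proof eventually_elim
    case (elim t)
    hence "y t \<in> cball (x t) \<rho>" by (simp add: dist_norm norm_minus_commute)
    thus ?case using elim by blast
  qed
  thus ?thesis using assms \<rho>(1) unfolding in_int_Linf_def has_margin_def by blast
qed

text \<open>It suffices to test the competitors \<open>x\<close> shifted by
  \<open>\<epsilon>\<close> along the signed basis vectors: there are finitely many of them, so one
  null set serves all, and convexity fills in the ball.\<close>

lemma in_int_imp_has_margin:
  fixes S :: "real \<Rightarrow> 'a::euclidean_space set"
  assumes cvx: "\<And>t. t \<in> space \<mu> \<Longrightarrow> convex (S t)" and x: "in_int_Linf \<mu> S x"
  shows "has_margin \<mu> S x"
proof -
  have [measurable]: "x \<in> borel_measurable \<mu>" using x unfolding in_int_Linf_def by blast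
  obtain \<epsilon> where \<epsilon>: "\<epsilon> > 0" "\<And>y. y \<in> borel_measurable \<mu> \<Longrightarrow>
      (AE t in \<mu>. norm (y t - x t) \<le> \<epsilon>) \<Longrightarrow> (AE t in \<mu>. y t \<in> S t)"
    using x unfolding in_int_Linf_def by blast
  have "AE t in \<mu>. \<forall>p\<in>(Basis :: 'a set) \<times> {-1, 1}. x t + (snd p * \<epsilon>) *\<^sub>R fst p \<in> S t"
  proof (rule AE_finite_allI)
    fix p assume p: "p \<in> (Basis :: 'a set) \<times> {-1, 1 :: real}"
    show "AE t in \<mu>. x t + (snd p * \<epsilon>) *\<^sub>R fst p \<in> S t"
      by (rule \<epsilon>(2)) (use p \<epsilon>(1) in \<open>auto intro!: AE_I2\<close>)
  qed simp
  hence "AE t in \<mu>. cball (x t) (\<epsilon> / (4 * DIM('a))) \<subseteq> S t"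
    using AE_space
  proof eventually_elim
    case (elim t)
    show ?case
    proof (rule convex_cball_subset_vertices[OF cvx[OF elim(2)] \<epsilon>(1)])
      fix b :: 'a and \<sigma> :: real assume "b \<in> Basis" "\<sigma> \<in> {-1, 1}"
      thus "x t + (\<sigma> * \<epsilon>) *\<^sub>R b \<in> S t" using bspec[OF elim(1), of "(b, \<sigma>)"] by auto
    qed
  qed
  moreover have "\<epsilon> / (4 * DIM('a)) > 0" using \<epsilon>(1) by simp
  ultimately show ?thesis using x unfolding has_margin_def in_int_Linf_def by blast
qed

lemma has_margin_If:
  assumes x: "has_margin \<mu> S x" and G: "{t\<in>space \<mu>. t \<in> G} \<in> sets \<mu>"
    and \<rho>: "\<rho> > 0" "\<And>t. t \<in> space \<mu> \<Longrightarrow> t \<in> G \<Longrightarrow> cball v \<rho> \<subseteq> S t"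
  shows "has_margin \<mu> S (\<lambda>t. if t \<in> G then v else x t)"
proof -
  obtain B where B: "AE t in \<mu>. norm (x t) \<le> B" using x unfolding has_margin_def by blast
  obtain r where r: "r > 0" "AE t in \<mu>. cball (x t) r \<subseteq> S t"
    using x unfolding has_margin_def by blast
  have "(\<lambda>t. if t \<in> G then v else x t) \<in> borel_measurable \<mu>"
    using x G unfolding has_margin_def by (intro measurable_If) auto
  moreover have "AE t in \<mu>. norm (if t \<in> G then v else x t) \<le> max B (norm v)"
    using B by eventually_elim auto
  moreover have "AE t in \<mu>. cball (if t \<in> G then v else x t) (min r \<rho>) \<subseteq> S t"
    using r(2) AE_space
  proof eventually_elim
    case (elim t)
    show ?case
    proof (cases "t \<in> G")
      case True
      have "cball v (min r \<rho>) \<subseteq> cball v \<rho>" by auto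
      thus ?thesis using \<rho>(2)[OF elim(2) True] True by auto
    next
      case False
      have "cball (x t) (min r \<rho>) \<subseteq> cball (x t) r" by auto
      thus ?thesis using elim False by auto
    qed
  qed
  moreover have "min r \<rho> > 0" using r(1) \<rho>(1) by simp
  ultimately show ?thesis unfolding has_margin_def by blast
qed

section \<open>The extended integral: monotonicity, finiteness and decreasing limits\<close>

lemma eintegral_mono:
  assumes "\<And>t. t \<in> space \<mu> \<Longrightarrow> f t \<le> g t"
  shows "eintegral \<mu> f \<le> eintegral \<mu> g"
proof -
  have P: "(\<integral>\<^sup>+ t. e2ennreal (f t) \<partial>\<mu>) \<le> (\<integral>\<^sup>+ t. e2ennreal (g t) \<partial>\<mu>)"
    using assms by (intro nn_integral_mono e2ennreal_mono)
  have N: "(\<integral>\<^sup>+ t. e2ennreal (- g t) \<partial>\<mu>) \<le> (\<integral>\<^sup>+ t. e2ennreal (- f t) \<partial>\<mu>)"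
    using assms by (intro nn_integral_mono e2ennreal_mono) simp
  show ?thesis
  proof (cases "(\<integral>\<^sup>+ t. e2ennreal (g t) \<partial>\<mu>) < \<infinity>")
    case True
    thus ?thesis unfolding eintegral_def
      using P N by (auto intro!: ereal_minus_mono simp flip: less_eq_ennreal.rep_eq)
  qed (simp add: eintegral_def)
qed

lemma eintegral_cong_AE:
  assumes "AE t in \<mu>. f t = g t"
  shows "eintegral \<mu> f = eintegral \<mu> g"
proof -
  have "(\<integral>\<^sup>+ t. e2ennreal (f t) \<partial>\<mu>) = (\<integral>\<^sup>+ t. e2ennreal (g t) \<partial>\<mu>)"
    "(\<integral>\<^sup>+ t. e2ennreal (- f t) \<partial>\<mu>) = (\<integral>\<^sup>+ t. e2ennreal (- g t) \<partial>\<mu>)"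
    using assms by (auto intro!: nn_integral_cong_AE)
  thus ?thesis by (simp add: eintegral_def)
qed

lemma e2ennreal_eq_ennreal: "e2ennreal (ereal r) = ennreal r"
  by (simp add: ennreal.abs_eq)

lemma eintegral_ereal:
  assumes "integrable \<mu> f"
  shows "eintegral \<mu> (\<lambda>t. ereal (f t)) = ereal (\<integral>t. f t \<partial>\<mu>)"
proof -
  have fin: "(\<integral>\<^sup>+ t. ennreal (f t) \<partial>\<mu>) \<noteq> \<infinity>" "(\<integral>\<^sup>+ t. ennreal (- f t) \<partial>\<mu>) \<noteq> \<infinity>"
    using assms unfolding real_integrable_def by auto
  have eq: "enn2ereal a = ereal (enn2real a)" if "a \<noteq> \<infinity>" for a
    using that by (cases a) auto
  show ?thesis
    using fin unfolding eintegral_def real_lebesgue_integral_def[OF assms]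
    by (simp add: e2ennreal_eq_ennreal eq less_top)
qed

lemma integrable_if_eintegral_finite:
  assumes [measurable]: "f \<in> borel_measurable \<mu>" and fin: "AE t in \<mu>. \<bar>f t\<bar> \<noteq> \<infinity>"
    and "\<bar>eintegral \<mu> f\<bar> \<noteq> \<infinity>"
  shows "integrable \<mu> (\<lambda>t. real_of_ereal (f t))"
    and "eintegral \<mu> f = ereal (\<integral>t. real_of_ereal (f t) \<partial>\<mu>)"
proof -
  define r where "r = (\<lambda>t. real_of_ereal (f t))"
  have [measurable]: "r \<in> borel_measurable \<mu>" unfolding r_def by measurable
  have "AE t in \<mu>. f t = ereal (r t)"
    using fin by eventually_elim (simp add: r_def ereal_real)
  hence eq: "eintegral \<mu> f = eintegral \<mu> (\<lambda>t. ereal (r t))"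
    by (rule eintegral_cong_AE)
  hence fin': "\<bar>eintegral \<mu> (\<lambda>t. ereal (r t))\<bar> \<noteq> \<infinity>" using assms(3) by simp
  \<comment> \<open>An infinite positive part would make the integral +\<infinity> by convention;
    given this, an infinite negative part would make it -\<infinity>.\<close>
  hence P: "(\<integral>\<^sup>+ t. ennreal (r t) \<partial>\<mu>) < \<infinity>"
    unfolding eintegral_def e2ennreal_eq_ennreal by (rule contrapos_np) simp
  have "(\<integral>\<^sup>+ t. ennreal (- r t) \<partial>\<mu>) \<noteq> \<infinity>"
  proof
    assume "(\<integral>\<^sup>+ t. ennreal (- r t) \<partial>\<mu>) = \<infinity>"
    hence "\<bar>eintegral \<mu> (\<lambda>t. ereal (r t))\<bar> = \<infinity>"
      using P unfolding eintegral_def uminus_ereal.simps e2ennreal_eq_ennreal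
      by (cases "\<integral>\<^sup>+ t. ennreal (r t) \<partial>\<mu>") auto
    thus False using fin' by simp
  qed
  hence int: "integrable \<mu> r" using P unfolding real_integrable_def by simp
  thus "integrable \<mu> (\<lambda>t. real_of_ereal (f t))" unfolding r_def .
  show "eintegral \<mu> f = ereal (\<integral>t. real_of_ereal (f t) \<partial>\<mu>)"
    unfolding eq eintegral_ereal[OF int] by (simp add: r_def)
qed

text \<open>Positive parts converge under the dominating function \<open>F 0\<close>, negative parts
  by monotone convergence. The limit may be -\<infinity>, but finiteness of its positive part rules
  out a difference of two infinities.\<close>

lemma eintegral_INF_tendsto:
  fixes F :: "nat \<Rightarrow> real \<Rightarrow> real"
  assumes int: "\<And>n. integrable \<mu> (F n)" and dec: "\<And>n t. F (Suc n) t \<le> F n t"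
  shows "(\<lambda>n. ereal (\<integral>t. F n t \<partial>\<mu>)) \<longlonglongrightarrow> eintegral \<mu> (\<lambda>t. INF n. ereal (F n t))"
proof -
  let ?p = "\<lambda>t. INF n. ereal (F n t)"
  have [measurable]: "F n \<in> borel_measurable \<mu>" for n using int by auto
  have antimono: "F n t \<le> F m t" if "m \<le> n" for m n t
    using that by (induction rule: dec_induct) (auto intro: order_trans[OF dec])
  have lim: "(\<lambda>n. ereal (F n t)) \<longlonglongrightarrow> ?p t" for t
    using antimono by (intro LIMSEQ_INF) (auto simp: decseq_def)
  have P: "(\<lambda>n. \<integral>\<^sup>+ t. e2ennreal (ereal (F n t)) \<partial>\<mu>) \<longlonglongrightarrow> (\<integral>\<^sup>+ t. e2ennreal (?p t) \<partial>\<mu>)"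
  proof (rule nn_integral_dominated_convergence[where w = "\<lambda>t. ennreal (F 0 t)"])
    show "AE t in \<mu>. e2ennreal (ereal (F n t)) \<le> ennreal (F 0 t)" for n
      unfolding e2ennreal_eq_ennreal by (intro AE_I2 ennreal_leI antimono) simp
    show "AE t in \<mu>. (\<lambda>n. e2ennreal (ereal (F n t))) \<longlonglongrightarrow> e2ennreal (?p t)"
      by (intro AE_I2 tendsto_e2ennrealI lim)
    show "(\<integral>\<^sup>+ t. ennreal (F 0 t) \<partial>\<mu>) < \<infinity>"
      using int[of 0] unfolding real_integrable_def by (simp add: less_top)
  qed measurable
  have N: "(\<lambda>n. \<integral>\<^sup>+ t. e2ennreal (- ereal (F n t)) \<partial>\<mu>) \<longlonglongrightarrow> (\<integral>\<^sup>+ t. e2ennreal (- ?p t) \<partial>\<mu>)"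
  proof (rule nn_integral_LIMSEQ)
    show "(\<lambda>n. e2ennreal (- ereal (F n t))) \<longlonglongrightarrow> e2ennreal (- ?p t)" for t
      using lim by (intro tendsto_e2ennrealI tendsto_uminus_ereal)
    show "incseq (\<lambda>n t. e2ennreal (- ereal (F n t)))"
      by (intro incseq_SucI le_funI e2ennreal_mono) (simp add: dec)
  qed measurable
  have P_fin: "(\<integral>\<^sup>+ t. e2ennreal (ereal (F n t)) \<partial>\<mu>) < \<infinity>" for n
    using int[of n] unfolding real_integrable_def e2ennreal_eq_ennreal by (simp add: less_top)
  have "(\<integral>\<^sup>+ t. e2ennreal (?p t) \<partial>\<mu>) \<le> (\<integral>\<^sup>+ t. e2ennreal (ereal (F 0 t)) \<partial>\<mu>)"
    by (intro nn_integral_mono e2ennreal_mono INF_lower) auto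
  hence p_fin: "(\<integral>\<^sup>+ t. e2ennreal (?p t) \<partial>\<mu>) < \<infinity>"
    using P_fin[of 0] by (rule le_less_trans)
  have "ereal (\<integral>t. F n t \<partial>\<mu>) = enn2ereal (\<integral>\<^sup>+ t. e2ennreal (ereal (F n t)) \<partial>\<mu>)
      - enn2ereal (\<integral>\<^sup>+ t. e2ennreal (- ereal (F n t)) \<partial>\<mu>)" for n
    unfolding eintegral_ereal[OF int, symmetric] eintegral_def using P_fin[of n] by simp
  moreover have "(\<lambda>n. enn2ereal (\<integral>\<^sup>+ t. e2ennreal (ereal (F n t)) \<partial>\<mu>)
      - enn2ereal (\<integral>\<^sup>+ t. e2ennreal (- ereal (F n t)) \<partial>\<mu>))
    \<longlonglongrightarrow> enn2ereal (\<integral>\<^sup>+ t. e2ennreal (?p t) \<partial>\<mu>) - enn2ereal (\<integral>\<^sup>+ t. e2ennreal (- ?p t) \<partial>\<mu>)"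
  proof (rule tendsto_diff_ereal_general)
    show "\<not> (enn2ereal (\<integral>\<^sup>+ t. e2ennreal (?p t) \<partial>\<mu>) = \<infinity> \<and> enn2ereal (\<integral>\<^sup>+ t. e2ennreal (- ?p t) \<partial>\<mu>) = \<infinity> \<or>
      enn2ereal (\<integral>\<^sup>+ t. e2ennreal (?p t) \<partial>\<mu>) = -\<infinity> \<and> enn2ereal (\<integral>\<^sup>+ t. e2ennreal (- ?p t) \<partial>\<mu>) = -\<infinity>)"
      using p_fin enn2ereal_nonneg[of "\<integral>\<^sup>+ t. e2ennreal (?p t) \<partial>\<mu>"] by auto
  qed (intro tendsto_enn2erealI P N)+
  ultimately show ?thesis
    using p_fin by (simp add: eintegral_def)
qed

subsection \<open>Decreasing approximations of the infimum\<close>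

text \<open>A running minimum in which \<open>g n\<close> competes only on \<open>J n\<close>. In
  the application, \<open>g n\<close> comes from a constant that is admissible there; elsewhere its
  real value may be a meaningless default.\<close>

primrec patched_min :: "(real \<Rightarrow> real) \<Rightarrow> (nat \<Rightarrow> real set) \<Rightarrow> (nat \<Rightarrow> real \<Rightarrow> real) \<Rightarrow> nat \<Rightarrow> real \<Rightarrow> real"
where
  "patched_min f J g 0 = f"
| "patched_min f J g (Suc n) = (\<lambda>t. if t \<in> J n \<and> g n t < patched_min f J g n t
     then g n t else patched_min f J g n t)"

text \<open>\<open>Ih_finite\<close> merges two hypotheses of the theorem, finiteness from above at
  interior functions and properness from below.\<close>

locale bv_integrand =
  fixes T :: real and h :: "real \<Rightarrow> 'a::euclidean_space \<Rightarrow> ereal" and \<mu> :: "real measure"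
  assumes T: "T > 0"
    and h: "convex_normal_integrand T h"
    and mu_space: "space \<mu> = {0..T}"
    and mu_sets: "sets \<mu> = sets (restrict_space borel {0..T})"
    and mu_atomless: "\<And>t. t \<in> {0..T} \<Longrightarrow> emeasure \<mu> {t} = 0"
    and lisc: "left_inner_semicontinuous T (\<lambda>t. edom (h t))"
    and Ih_finite: "\<And>x. x \<in> BVspace T \<Longrightarrow> has_margin \<mu> (\<lambda>t. edom (h t)) x \<Longrightarrow> \<bar>Ih \<mu> h x\<bar> \<noteq> \<infinity>"
begin

section \<open>Integrands of interior BV functions and their closure in mean\<close>

definition interior_BV :: "(real \<Rightarrow> 'a) set" where
  "interior_BV = {x \<in> BVspace T. has_margin \<mu> (\<lambda>t. edom (h t)) x}"

text \<open>Real-valued so that Bochner integrals apply. Outside the domain it is the default 0,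
  hence the domain condition in \<open>ereal_hval\<close>.\<close>

definition hval :: "(real \<Rightarrow> 'a) \<Rightarrow> real \<Rightarrow> real" where
  "hval x t = real_of_ereal (h t (x t))"

text \<open>Membership in the \<open>L\<^sup>1\<close> closure of the integrands of interior
  functions. Patching on a measurable set may leave the BV space, but it stays in this closure, so
  the iteration runs here.\<close>

definition approximable :: "(real \<Rightarrow> real) \<Rightarrow> bool" where
  "approximable f \<longleftrightarrow> integrable \<mu> f \<and> (\<forall>\<delta>>0. \<exists>x\<in>interior_BV. (\<integral>t. \<bar>hval x t - f t\<bar> \<partial>\<mu>) < \<delta>)"

lemma h_not_MInf: "t \<in> {0..T} \<Longrightarrow> h t v \<noteq> -\<infinity>"
  using h unfolding convex_normal_integrand_def by blast

lemma convex_epi_h: "t \<in> {0..T} \<Longrightarrow> convex (epi (h t))"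
  using h unfolding convex_normal_integrand_def by blast

lemma ereal_hval: "t \<in> {0..T} \<Longrightarrow> x t \<in> edom (h t) \<Longrightarrow> h t (x t) = ereal (hval x t)"
  using h_not_MInf[of t "x t"] unfolding hval_def edom_def by (cases "h t (x t)") auto

lemma Int_space_sets: "B \<in> sets borel \<Longrightarrow> B \<inter> {0..T} \<in> sets \<mu>"
  unfolding mu_sets sets_restrict_space by (auto simp: Int_commute)

lemma hval_measurable [measurable]: "x \<in> borel_measurable \<mu> \<Longrightarrow> hval x \<in> borel_measurable \<mu>"
  unfolding hval_def[abs_def] using normal_integrand_measurable[OF h mu_space mu_sets] by measurable

lemma interior_BV_dom:
  assumes "x \<in> interior_BV"
  shows "AE t in \<mu>. x t \<in> edom (h t)"
proof -
  obtain \<rho> where "\<rho> > 0" "AE t in \<mu>. cball (x t) \<rho> \<subseteq> edom (h t)"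
    using assms unfolding interior_BV_def has_margin_def by blast
  thus ?thesis by (auto elim!: eventually_mono)
qed

lemma hval_integrable:
  assumes "x \<in> interior_BV"
  shows "integrable \<mu> (hval x)" and "Ih \<mu> h x = ereal (\<integral>t. hval x t \<partial>\<mu>)"
proof -
  have x: "x \<in> borel_measurable \<mu>" "\<bar>Ih \<mu> h x\<bar> \<noteq> \<infinity>"
    using assms Ih_finite[of x] by (simp_all add: interior_BV_def has_margin_def)
  have m: "(\<lambda>t. h t (x t)) \<in> borel_measurable \<mu>"
    by (rule normal_integrand_measurable[OF h mu_space mu_sets x(1)])
  have fin: "AE t in \<mu>. \<bar>h t (x t)\<bar> \<noteq> \<infinity>"
    using interior_BV_dom[OF assms] AE_space
    by eventually_elim (simp add: ereal_hval mu_space)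
  show "integrable \<mu> (hval x)" "Ih \<mu> h x = ereal (\<integral>t. hval x t \<partial>\<mu>)"
    using integrable_if_eintegral_finite[OF m fin] x(2)
    unfolding Ih_def hval_def[abs_def] by simp_all
qed

lemma interior_BV_If:
  assumes x: "x \<in> interior_BV" and G: "G \<in> BV_sets T"
    and \<rho>: "\<rho> > 0" "\<And>t. t \<in> G \<Longrightarrow> cball v \<rho> \<subseteq> edom (h t)"
  shows "(\<lambda>t. if t \<in> G then v else x t) \<in> interior_BV"
proof -
  have "{t\<in>space \<mu>. t \<in> G} = G \<inter> {0..T}" by (auto simp: mu_space)
  hence "{t\<in>space \<mu>. t \<in> G} \<in> sets \<mu>"
    using G Int_space_sets by (simp add: BV_sets_def)
  thus ?thesis
    using x unfolding interior_BV_def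
    by (auto intro!: BVspace_If[OF G] BVspace_const has_margin_If[OF _ _ \<rho>])
qed

lemma approximable_hval: "x \<in> interior_BV \<Longrightarrow> approximable (hval x)"
  unfolding approximable_def using hval_integrable by (auto intro!: bexI[of _ x])

text \<open>The patched set \<open>E\<close> is replaced by a finite union of left-open intervals that is close to it
  with respect to a measure under which both competing integrands are controlled.\<close>
lemma approximable_patch:
  assumes f: "approximable f" and ab: "0 \<le> a" "b \<le> T"
    and \<rho>: "\<rho> > 0" "\<And>t. t \<in> {a<..b} \<Longrightarrow> cball v \<rho> \<subseteq> edom (h t)"
    and E: "E \<in> sets \<mu>" "E \<subseteq> {a<..b}"
  shows "approximable (\<lambda>t. if t \<in> E then hval (\<lambda>_. v) t else f t)" (is "approximable ?f'")
proof -
  define J where "J = {a<..b}"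
  have J: "J \<in> BV_sets T" unfolding J_def by (rule BV_sets_greaterThanAtMost[OF ab])
  have J_sub: "J \<subseteq> {0..T}" using ab by (auto simp: J_def)
  have J_sets: "J \<in> sets \<mu>" using Int_space_sets[of J] J_sub by (simp add: J_def Int_absorb2)
  \<comment> \<open>Cut off to \<open>J\<close>, since \<open>v\<close> need not lie in the domains
    elsewhere. Its integrability is inherited from an interior function that equals \<open>v\<close>
    on \<open>J\<close>.\<close>
  define g where "g t = indicator J t *\<^sub>R hval (\<lambda>_. v) t" for t
  have f_int: "integrable \<mu> f" using f unfolding approximable_def by blast
  obtain x0 where x0: "x0 \<in> interior_BV"
    using f unfolding approximable_def by (meson zero_less_one)
  have "(\<lambda>t. if t \<in> J then v else x0 t) \<in> interior_BV"
    by (rule interior_BV_If[OF x0 J \<rho>(1)]) (use \<rho>(2) in \<open>auto simp: J_def\<close>)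
  hence "integrable \<mu> (hval (\<lambda>t. if t \<in> J then v else x0 t))" by (rule hval_integrable)
  hence "integrable \<mu> (\<lambda>t. indicator J t *\<^sub>R hval (\<lambda>t. if t \<in> J then v else x0 t) t)"
    by (rule integrable_mult_indicator[OF J_sets])
  also have "(\<lambda>t. indicator J t *\<^sub>R hval (\<lambda>t. if t \<in> J then v else x0 t) t) = g"
    by (auto simp: g_def hval_def indicator_def)
  finally have g_int: "integrable \<mu> g" .
  have "integrable \<mu> (\<lambda>t. indicator E t *\<^sub>R g t + (f t - indicator E t *\<^sub>R f t))"
    using E(1) f_int g_int
    by (intro Bochner_Integration.integrable_add Bochner_Integration.integrable_diff integrable_mult_indicator)
  also have "(\<lambda>t. indicator E t *\<^sub>R g t + (f t - indicator E t *\<^sub>R f t)) = ?f'"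
  proof
    fix t
    have "t \<in> E \<Longrightarrow> t \<in> J" using E(2) by (auto simp: J_def)
    thus "indicator E t *\<^sub>R g t + (f t - indicator E t *\<^sub>R f t) = ?f' t"
      by (cases "t \<in> E") (simp_all add: g_def)
  qed
  finally have f'_int: "integrable \<mu> ?f'" .
  have "\<exists>x\<in>interior_BV. (\<integral>t. \<bar>hval x t - ?f' t\<bar> \<partial>\<mu>) < \<delta>" if "\<delta> > 0" for \<delta>
  proof -
    obtain x where x: "x \<in> interior_BV" "(\<integral>t. \<bar>hval x t - f t\<bar> \<partial>\<mu>) < \<delta> / 2"
      using f half_gt_zero[OF \<open>\<delta> > 0\<close>] unfolding approximable_def by blast
    note x_int = hval_integrable(1)[OF x(1)]
    \<comment> \<open>Replacing \<open>E\<close> by \<open>G\<close> causes an extra error of at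
      most \<open>w\<close>, and only on their symmetric difference; so the difference must be small
      for the measure with density \<open>w\<close>.\<close>
    define w where "w t = \<bar>hval x t\<bar> + \<bar>g t\<bar>" for t
    have w_int: "integrable \<mu> w"
      unfolding w_def[abs_def] using x_int g_int
      by (intro Bochner_Integration.integrable_add integrable_abs)
    have w_nonneg: "0 \<le> w t" for t by (simp add: w_def)
    have [measurable]: "w \<in> borel_measurable \<mu>" using w_int by simp
    define \<nu> where "\<nu> = density \<mu> (\<lambda>t. ennreal (w t))"
    have "emeasure \<nu> (space \<nu>) = (\<integral>\<^sup>+ t. ennreal (w t) \<partial>\<mu>)"
      unfolding \<nu>_def by (auto simp: emeasure_density intro!: nn_integral_cong)
    hence "finite_measure \<nu>"
      using w_int w_nonneg by (intro finite_measureI) (simp add: nn_integral_eq_integral)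
    moreover have sets_\<nu>: "sets \<nu> = sets \<mu>" by (simp add: \<nu>_def)
    ultimately obtain G where G: "G \<in> BV_sets T" "measure \<nu> (sym_diff E (G \<inter> {0..T})) < \<delta> / 2"
      using BV_sets_approx[OF T, of \<nu> E "\<delta> / 2"] \<open>\<delta> > 0\<close> E(1) mu_sets by auto
    define S where "S = sym_diff E (G \<inter> {0..T})"
    have S: "S \<in> sets \<mu>"
      unfolding S_def using E(1) G(1) Int_space_sets[of G]
      by (intro sets.Un sets.Diff) (auto simp: BV_sets_def)
    have S_int: "(\<integral>t. w t * indicator S t \<partial>\<mu>) = measure \<nu> S"
    proof -
      have "(\<integral>t. w t * indicator S t \<partial>\<mu>) = (\<integral>t. indicator S t \<partial>\<nu>)"
        unfolding \<nu>_def using S w_nonneg by (intro integral_real_density[symmetric]) auto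
      also have "\<dots> = measure \<nu> S"
        using sets.sets_into_space[OF S] by (simp add: \<nu>_def Int_absorb2)
      finally show ?thesis .
    qed
    \<comment> \<open>The approximating set \<open>G\<close> may leave \<open>J\<close>, where
      \<open>v\<close> is not known to be admissible.\<close>
    define x' where "x' t = (if t \<in> G \<inter> J then v else x t)" for t
    have x': "x' \<in> interior_BV"
      unfolding x'_def[abs_def]
      by (rule interior_BV_If[OF x(1) BV_sets_Int[OF G(1) J] \<rho>(1)]) (use \<rho>(2) in \<open>auto simp: J_def\<close>)
    have pointwise: "\<bar>hval x' t - ?f' t\<bar> \<le> \<bar>hval x t - f t\<bar> + w t * indicator S t"
      if t: "t \<in> space \<mu>" for t
    proof -
      have "t \<in> S \<longleftrightarrow> (t \<in> E) \<noteq> (t \<in> G)" using t by (auto simp: S_def mu_space)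
      moreover have "t \<in> E \<Longrightarrow> t \<in> J" using E(2) by (auto simp: J_def)
      moreover have "hval x' t = (if t \<in> G \<inter> J then hval (\<lambda>_. v) t else hval x t)"
        by (simp add: hval_def x'_def)
      ultimately show ?thesis
        by (cases "t \<in> E"; cases "t \<in> G"; cases "t \<in> J") (auto simp: w_def g_def)
    qed
    have wS_int: "integrable \<mu> (\<lambda>t. w t * indicator S t)"
      using integrable_mult_indicator[OF S w_int] by (simp add: mult.commute)
    have "(\<integral>t. \<bar>hval x' t - ?f' t\<bar> \<partial>\<mu>) \<le> (\<integral>t. \<bar>hval x t - f t\<bar> + w t * indicator S t \<partial>\<mu>)"
      using pointwise hval_integrable(1)[OF x'] f'_int x_int f_int wS_int
      by (intro integral_mono Bochner_Integration.integrable_add integrable_abs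
          Bochner_Integration.integrable_diff) auto
    also have "\<dots> = (\<integral>t. \<bar>hval x t - f t\<bar> \<partial>\<mu>) + (\<integral>t. w t * indicator S t \<partial>\<mu>)"
      using x_int f_int wS_int by (intro Bochner_Integration.integral_add integrable_abs
          Bochner_Integration.integrable_diff)
    also have "\<dots> < \<delta>" using x(2) G(2) unfolding S_int S_def[symmetric] by linarith
    finally show ?thesis using x' by blast
  qed
  thus ?thesis unfolding approximable_def using f'_int by blast
qed

lemma INF_le_approximable:
  assumes "approximable f"
  shows "(INF x\<in>BVspace T. Ih \<mu> h x) \<le> ereal (\<integral>t. f t \<partial>\<mu>)"
proof (rule ereal_le_epsilon2)
  fix \<delta> :: real assume "\<delta> > 0"
  then obtain x where x: "x \<in> interior_BV" "(\<integral>t. \<bar>hval x t - f t\<bar> \<partial>\<mu>) < \<delta>"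
    using assms unfolding approximable_def by blast
  have f: "integrable \<mu> f" using assms unfolding approximable_def by blast
  note x_int = hval_integrable[OF x(1)]
  have "(\<integral>t. hval x t \<partial>\<mu>) - (\<integral>t. f t \<partial>\<mu>) = (\<integral>t. hval x t - f t \<partial>\<mu>)"
    using x_int(1) f by (simp add: Bochner_Integration.integral_diff)
  also have "\<dots> \<le> (\<integral>t. \<bar>hval x t - f t\<bar> \<partial>\<mu>)"
    using x_int(1) f by (intro integral_mono) auto
  finally have "(\<integral>t. hval x t \<partial>\<mu>) \<le> (\<integral>t. f t \<partial>\<mu>) + \<delta>" using x(2) by linarith
  hence "Ih \<mu> h x \<le> ereal (\<integral>t. f t \<partial>\<mu>) + ereal \<delta>" unfolding x_int(2) by simp
  moreover have "x \<in> BVspace T" using x(1) by (simp add: interior_BV_def)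
  ultimately show "(INF x\<in>BVspace T. Ih \<mu> h x) \<le> ereal (\<integral>t. f t \<partial>\<mu>) + ereal \<delta>"
    by (rule INF_lower2[rotated])
qed

section \<open>Countably many admissible constants and the passage to the limit\<close>

definition uniform_ball :: "'a \<Rightarrow> real \<Rightarrow> real \<Rightarrow> bool" where
  "uniform_ball v a b \<longleftrightarrow> (\<exists>\<rho>>0. \<forall>r\<in>{a<..b}. cball v \<rho> \<subseteq> edom (h r))"

text \<open>\<open>lisc_cball\<close> gives a uniform ball on an interval ending exactly at
  \<open>t\<close>. By \<open>countable_not_covered\<close>, only countably many such
  \<open>t\<close> escape the rational intervals, and countable sets are null for an atomless
  measure.\<close>

lemma AE_covered:
  "AE t in \<mu>. (\<exists>\<rho>>0. cball v \<rho> \<subseteq> edom (h t)) \<longrightarrow>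
     (\<exists>a\<in>\<rat>. \<exists>b\<in>\<rat>. 0 \<le> a \<and> b \<le> T \<and> t \<in> {a<..b} \<and> uniform_ball v a b)"
proof -
  define C where "C t \<longleftrightarrow> (\<exists>a\<in>\<rat>. \<exists>b\<in>\<rat>. 0 \<le> a \<and> b \<le> T \<and> t \<in> {a<..b} \<and> uniform_ball v a b)" for t
  \<comment> \<open>The point 0 has no left interval inside \<open>[0,T]\<close> and is discarded
    separately.\<close>
  define N where "N = insert 0 {t\<in>{0<..T}. (\<exists>s<t. 0 \<le> s \<and> uniform_ball v s t) \<and> \<not> C t}"
  have "countable N"
    unfolding N_def C_def countable_insert_eq
    by (rule countable_not_covered) (force simp: uniform_ball_def)
  have N_sub: "N \<subseteq> {0..T}" using T by (auto simp: N_def)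
  have "(\<Union>t\<in>N. {t}) \<in> null_sets \<mu>"
  proof (rule null_sets_UN'[OF \<open>countable N\<close>])
    fix t assume "t \<in> N"
    hence "t \<in> {0..T}" using N_sub by blast
    thus "{t} \<in> null_sets \<mu>"
      using mu_atomless[of t] Int_space_sets[of "{t}"] by (intro null_setsI) auto
  qed
  hence "AE t in \<mu>. t \<notin> N" by (auto dest: AE_not_in)
  hence "AE t in \<mu>. (\<exists>\<rho>>0. cball v \<rho> \<subseteq> edom (h t)) \<longrightarrow> C t"
    using AE_space
  proof eventually_elim
    case (elim t)
    show ?case
    proof
      assume "\<exists>\<rho>>0. cball v \<rho> \<subseteq> edom (h t)"
      then obtain \<rho> where \<rho>: "\<rho> > 0" "cball v \<rho> \<subseteq> edom (h t)" by blast
      have t: "t \<in> {0<..T}" using elim by (auto simp: N_def mu_space)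
      hence t': "t \<in> {0..T}" by auto
      obtain s where s: "s < t" "\<And>r. r \<in> {s<..t} \<Longrightarrow> r \<in> {0..T} \<Longrightarrow>
          cball v (\<rho> / (4 * DIM('a))) \<subseteq> edom (h r)"
        using lisc_cball[OF lisc convex_edom[OF convex_epi_h] t' \<rho>] by blast
      have "cball v (\<rho> / (4 * DIM('a))) \<subseteq> edom (h r)" if "r \<in> {max s 0<..t}" for r
        by (rule s(2)) (use that t in auto)
      moreover have "\<rho> / (4 * DIM('a)) > 0" using \<rho>(1) by simp
      ultimately have "uniform_ball v (max s 0) t" unfolding uniform_ball_def by blast
      hence "\<exists>s<t. 0 \<le> s \<and> uniform_ball v s t"
        using s(1) t by (intro exI[of _ "max s 0"]) auto
      thus "C t" using elim(1) t unfolding N_def by blast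
    qed
  qed
  thus ?thesis unfolding C_def .
qed

text \<open>The function \<open>x\<close> has two uses: its integrand is the integrable first term
  of the decreasing sequence, and its margin supplies the interior point of almost every domain that
  \<open>exists_dense_near_inf\<close> requires.\<close>

lemma INF_le_eintegral:
  assumes x: "x \<in> interior_BV"
  shows "(INF x\<in>BVspace T. Ih \<mu> h x) \<le> eintegral \<mu> (\<lambda>t. INF v. h t v)"
proof -
  obtain Q :: "'a set" where Q: "countable Q" "\<And>U. open U \<Longrightarrow> U \<noteq> {} \<Longrightarrow> \<exists>d\<in>Q. d \<in> U"
    using countable_dense_setE by blast
  define K where "K = {(v, a, b). v \<in> Q \<and> a \<in> \<rat> \<and> b \<in> \<rat> \<and> 0 \<le> a \<and> b \<le> T \<and> uniform_ball v a b}"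
  have "countable K"
    by (rule countable_subset[of _ "Q \<times> \<rat> \<times> \<rat>"]) (auto simp: K_def Q(1) countable_rat)
  obtain q where "q \<in> Q" using Q(2)[of UNIV] by blast
  \<comment> \<open>The empty interval satisfies \<open>uniform_ball\<close> vacuously; a nonempty
    \<open>K\<close> makes \<open>from_nat_into\<close> an enumeration of its elements.\<close>
  hence "(q, 0, 0) \<in> K" using T by (auto simp: K_def uniform_ball_def intro: exI[of _ "1::real"])
  hence "K \<noteq> {}" by blast
  define v where "v n = fst (from_nat_into K n)" for n
  define a where "a n = fst (snd (from_nat_into K n))" for n
  define b where "b n = snd (snd (from_nat_into K n))" for n
  have K: "(v n, a n, b n) \<in> K" for n
    using from_nat_into[OF \<open>K \<noteq> {}\<close>, of n] by (simp add: v_def a_def b_def)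
  have ab: "0 \<le> a n" "b n \<le> T" "uniform_ball (v n) (a n) (b n)" for n
    using K[of n] by (auto simp: K_def)
  define J where "J n = {a n<..b n}" for n
  define g where "g n = hval (\<lambda>_. v n)" for n
  define F where "F = patched_min (hval x) J g"
  have F_0: "F 0 = hval x" and
    F_Suc: "F (Suc n) = (\<lambda>t. if t \<in> J n \<and> g n t < F n t then g n t else F n t)" for n
    unfolding F_def by simp_all
  have J_sub: "J n \<subseteq> {0..T}" for n using ab[of n] by (auto simp: J_def)
  have appr: "approximable (F n)" for n
  proof (induction n)
    case 0
    show ?case unfolding F_0 by (rule approximable_hval[OF x])
  next
    case (Suc n)
    \<comment> \<open>The set where the new candidate wins, in the measurable form that
      \<open>approximable_patch\<close> expects.\<close>
    define E where "E = {t\<in>space \<mu>. g n t < F n t} \<inter> (J n \<inter> {0..T})"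
    have [measurable]: "F n \<in> borel_measurable \<mu>" using Suc unfolding approximable_def by auto
    have [measurable]: "g n \<in> borel_measurable \<mu>" unfolding g_def by measurable
    have E: "E \<in> sets \<mu>"
      unfolding E_def by (intro sets.Int Int_space_sets) (auto simp: J_def)
    obtain \<rho> where \<rho>: "\<rho> > 0" "\<And>t. t \<in> {a n<..b n} \<Longrightarrow> cball (v n) \<rho> \<subseteq> edom (h t)"
      using ab(3)[of n] unfolding uniform_ball_def by blast
    have "approximable (\<lambda>t. if t \<in> E then hval (\<lambda>_. v n) t else F n t)"
      by (rule approximable_patch[OF Suc ab(1,2) \<rho> E]) (auto simp: E_def J_def)
    also have "(\<lambda>t. if t \<in> E then hval (\<lambda>_. v n) t else F n t) = F (Suc n)"
    proof
      fix t
      have "t \<in> E \<longleftrightarrow> t \<in> J n \<and> g n t < F n t"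
        using J_sub[of n] by (auto simp: E_def mu_space)
      thus "(if t \<in> E then hval (\<lambda>_. v n) t else F n t) = F (Suc n) t"
        unfolding F_Suc by (simp add: g_def)
    qed
    finally show ?case .
  qed
  have dec: "F (Suc n) t \<le> F n t" for n t by (simp add: F_Suc)
  have lower: "AE t in \<mu>. \<forall>n. (INF v. h t v) \<le> ereal (F n t)"
    using interior_BV_dom[OF x] AE_space
  proof eventually_elim
    case (elim t)
    hence t: "t \<in> {0..T}" by (simp add: mu_space)
    have "(INF v. h t v) \<le> ereal (F n t)" for n
    proof (induction n)
      case 0
      show ?case unfolding F_0 ereal_hval[of t x, OF t elim(1), symmetric] by (rule INF_lower) simp
    next
      case (Suc n)
      \<comment> \<open>On \<open>J n\<close> the value \<open>g n t\<close> is a genuine value of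
        \<open>h t\<close>, not the default.\<close>
      have "(INF v. h t v) \<le> ereal (g n t)" if "t \<in> J n"
      proof -
        have "v n \<in> edom (h t)"
          using ab(3)[of n] that unfolding uniform_ball_def J_def by force
        from ereal_hval[OF t, of "\<lambda>_. v n", OF this] show ?thesis
          unfolding g_def by (metis INF_lower UNIV_I)
      qed
      thus ?case using Suc by (simp add: F_Suc)
    qed
    thus ?case by blast
  qed
  have cover: "AE t in \<mu>. \<forall>u\<in>Q. (\<exists>\<rho>>0. cball u \<rho> \<subseteq> edom (h t)) \<longrightarrow>
     (\<exists>a\<in>\<rat>. \<exists>b\<in>\<rat>. 0 \<le> a \<and> b \<le> T \<and> t \<in> {a<..b} \<and> uniform_ball u a b)"
    using AE_covered by (subst AE_ball_countable[OF Q(1)]) blast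
  obtain \<rho> where \<rho>: "\<rho> > 0" "AE t in \<mu>. cball (x t) \<rho> \<subseteq> edom (h t)"
    using x unfolding interior_BV_def has_margin_def by blast
  have "AE t in \<mu>. (INF v. h t v) = (INF n. ereal (F n t))"
    using lower cover \<rho>(2) AE_space
  proof eventually_elim
    case (elim t)
    hence t: "t \<in> {0..T}" by (simp add: mu_space)
    show ?case
    proof (rule antisym)
      show "(INF v. h t v) \<le> (INF n. ereal (F n t))"
        using elim(1) by (intro INF_greatest) blast
      show "(INF n. ereal (F n t)) \<le> (INF v. h t v)"
      proof (rule dense_ge)
        fix c assume c: "(INF v. h t v) < c"
        obtain u r where u: "u \<in> Q" "r > 0" "cball u r \<subseteq> edom (h t)" "h t u < c"
          using exists_dense_near_inf[OF convex_epi_h[OF t] \<rho>(1) elim(3) h_not_MInf[OF t] Q(2) c] by blast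
        obtain a' b' where "a' \<in> \<rat>" "b' \<in> \<rat>" "0 \<le> a'" "b' \<le> T" "t \<in> {a'<..b'}" "uniform_ball u a' b'"
          using elim(2) u(1-3) by blast
        hence "(u, a', b') \<in> K" using u(1) by (simp add: K_def)
        then obtain n where n: "from_nat_into K n = (u, a', b')"
          using from_nat_into_surj[OF \<open>countable K\<close>] by blast
        hence "t \<in> J n" "v n = u"
          using \<open>t \<in> {a'<..b'}\<close> by (simp_all add: J_def a_def b_def v_def)
        \<comment> \<open>Candidate \<open>n\<close> enters the minimum at stage
          \<open>Suc n\<close>.\<close>
        hence "F (Suc n) t \<le> hval (\<lambda>_. u) t" by (simp add: F_Suc g_def)
        moreover have "u \<in> edom (h t)" using u(2,3) by force
        ultimately have "ereal (F (Suc n) t) \<le> h t u"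
          using ereal_hval[OF t, of "\<lambda>_. u"] by simp
        hence "(INF n. ereal (F n t)) \<le> h t u" by (intro INF_lower2[of "Suc n"]) auto
        thus "(INF n. ereal (F n t)) \<le> c" using u(4) by simp
      qed
    qed
  qed
  hence "eintegral \<mu> (\<lambda>t. INF v. h t v) = eintegral \<mu> (\<lambda>t. INF n. ereal (F n t))"
    by (rule eintegral_cong_AE)
  moreover have "(\<lambda>n. ereal (\<integral>t. F n t \<partial>\<mu>)) \<longlonglongrightarrow> eintegral \<mu> (\<lambda>t. INF n. ereal (F n t))"
    using appr dec by (intro eintegral_INF_tendsto) (auto simp: approximable_def)
  ultimately show ?thesis
    using INF_le_approximable[OF appr] by (auto intro: LIMSEQ_le_const)
qed

end

section \<open>The interchange of infimum and integral\<close>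

theorem theorem1:
  fixes T :: real and h :: "real \<Rightarrow> 'a::euclidean_space \<Rightarrow> ereal" and \<mu> :: "real measure"
  assumes T: "T > 0"
    and h: "convex_normal_integrand T h"
    and mu_space: "space \<mu> = {0..T}"
    and mu_sets: "sets \<mu> = sets (restrict_space borel {0..T})"
    and mu_finite: "emeasure \<mu> {0..T} < \<infinity>"
    and mu_atomless: "\<forall>t\<in>{0..T}. emeasure \<mu> {t} = 0"
    and mu_support: "\<forall>U. open U \<longrightarrow> U \<inter> {0..T} \<noteq> {} \<longrightarrow> emeasure \<mu> (U \<inter> {0..T}) > 0"
    and lisc: "left_inner_semicontinuous T (\<lambda>t. edom (h t))"
    and int_dom: "\<forall>x\<in>BVspace T. in_int_Linf \<mu> (\<lambda>t. edom (h t)) x \<longrightarrow> Ih \<mu> h x < \<infinity>"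
    and dom_cl: "\<forall>x\<in>BVspace T. Ih \<mu> h x < \<infinity> \<longrightarrow> (\<forall>t\<in>{0..T}. x t \<in> closure (edom (h t)))"
    and proper1: "\<forall>x\<in>BVspace T. Ih \<mu> h x > -\<infinity>"
    and proper2: "\<exists>x\<in>BVspace T. Ih \<mu> h x < \<infinity>"
    and nonempty: "\<exists>x\<in>BVspace T. in_int_Linf \<mu> (\<lambda>t. edom (h t)) x"
  shows "(INF x\<in>BVspace T. Ih \<mu> h x) = eintegral \<mu> (\<lambda>t. INF v. h t v)"
proof -
  interpret bv_integrand T h \<mu>
  proof
    fix x assume x: "x \<in> BVspace T" "has_margin \<mu> (\<lambda>t. edom (h t)) x"
    have "Ih \<mu> h x < \<infinity>" using int_dom x has_margin_imp_in_int by blast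
    moreover have "Ih \<mu> h x > -\<infinity>" using proper1 x by blast
    ultimately show "\<bar>Ih \<mu> h x\<bar> \<noteq> \<infinity>" by auto
  qed (use assms in auto)
  obtain x where "x \<in> BVspace T" "in_int_Linf \<mu> (\<lambda>t. edom (h t)) x" using nonempty by blast
  moreover have "has_margin \<mu> (\<lambda>t. edom (h t)) x"
    by (rule in_int_imp_has_margin) (use calculation convex_edom convex_epi_h mu_space in auto)
  ultimately have x: "x \<in> interior_BV" by (simp add: interior_BV_def)
  show ?thesis
  proof (rule antisym)
    show "(INF x\<in>BVspace T. Ih \<mu> h x) \<le> eintegral \<mu> (\<lambda>t. INF v. h t v)"
      by (rule INF_le_eintegral[OF x])
    \<comment> \<open>The integrands compare pointwise, and \<open>eintegral_mono\<close> accepts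
      arbitrary functions, in particular the pointwise infimum.\<close>
    show "eintegral \<mu> (\<lambda>t. INF v. h t v) \<le> (INF x\<in>BVspace T. Ih \<mu> h x)"
      unfolding Ih_def by (intro INF_greatest eintegral_mono INF_lower) simp
  qed
qed

end
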